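(* Let $m,d\ge 1$ be integers, let $\{p^{\rm obs}(ab|xy)\}\in Q$ be a quantum behavior with $a,b\in[d]$, $x,y\in\{1,\dots,m\}$, and let $x^*,y^*\in\{1,\dots,m\}$. Let $\mathcal{R}^{\rm NL}_{x^*,y^*}$ be the set of behaviors $\{p(ab|xy)\}$ that admit a quantum realization $p(ab|xy)=\mathrm{Tr}[(M_{a|x}\otimes M_{b|y})\rho_{AB}]$ in which Alice's POVMs $\{M_{a|x}\}$ have compatibility structure $\mathcal{C}_A\supseteq K_{1,m-1}(x^* )$ and Bob's POVMs $\{M_{b|y}\}$ have compatibility structure $\mathcal{C}_B\supseteq K_{1,m-1}(y^* )$. Then $$P^{\rm NL}_{\rm guess}(x^*,y^* )<1\quad\Longleftrightarrow\quad \{p^{\rm obs}(ab|xy)\}\notin\mathcal{R}^{\rm NL}_{x^*,y^*}.$$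
   Context: $[d]=\{0,\dots,d-1\}$. The quantum set $Q$ is the set of behaviors of the form $p(ab|xy)=\mathrm{Tr}[(M_{a|x}\otimes M_{b|y})\rho_{AB}]$, where $\rho_{AB}$ is a density operator on a tensor product of two finite-dimensional Hilbert spaces (of arbitrary dimension), $\{M_{a|x}\}_a$ is a POVM on $A$ for each $x$ and $\{M_{b|y}\}_b$ a POVM on $B$ for each $y$. Guessing probability: $$P^{\rm NL}_{\rm guess}(x^*,y^* )=\max_{\{p^{ee'}(ab|xy)\}}\sum_{e,e'\in[d]}p^{ee'}(a=e,b=e'|x^*,y^* )$$ over families $\{p^{ee'}\}_{e,e'\in[d]}$ with $\sum_{ee'}p^{ee'}(ab|xy)=p^{\rm obs}(ab|xy)$ for all $a,b,x,y$, where each $p^{ee'}$ is an unnormalized quantum behavior, i.e. a nonnegative multiple of an element of $Q$. The maximum equals $1$ means that some feasible family attains the value $1$. Compatibility: a set of POVMs $\{M_{a|x}\}_{a}$, $x\in S$, is compatible if there are a POVM $\{G_\lambda\}$ and conditional probability distributions $p(a|x,\lambda)$ with $M_{a|x}=\sum_\lambda p(a|x,\lambda)G_\lambda$ for all $a$ and $x\in S$. The compatibility structure of $m$ POVMs is the hypergraph on $\{1,\dots,m\}$ whose hyperedges are the compatible subsets. $K_{1,m-1}(x^* )$ is the star graph with centre $x^*$ and edges $\{x^*,x'\}$, $x'\neq x^*$; so $\mathcal{C}_A\supseteq K_{1,m-1}(x^* )$ means that for each $x'\ne x^*$ the POVMs $x^*$ and $x'$ are compatible (similarly for Bob). *)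

theory Defs
  imports "Jordan_Normal_Form.Matrix"
begin

text \<open>Operators on the Hilbert space \<open>\<complex>\<^sup>n\<close> are \<open>n \<times> n\<close> complex matrices; matrices with carriers are
  used because the dimensions are existentially quantified.\<close>

text \<open>The order on \<^typ>\<open>complex\<close> makes \<open>0 \<le> z\<close> say that \<open>z\<close> is real and nonnegative, so this
  condition also forces \<open>A\<close> to be Hermitian.\<close>

definition psd :: "nat \<Rightarrow> complex mat \<Rightarrow> bool" where
  "psd n A \<longleftrightarrow> A \<in> carrier_mat n n \<and> (\<forall>v \<in> carrier_vec n. 0 \<le> (A *\<^sub>v v) \<bullet>c v)"

definition mat_trace :: "complex mat \<Rightarrow> complex" where
  "mat_trace A = (\<Sum>i<dim_row A. A $$ (i, i))"

definition mat_sum :: "nat \<Rightarrow> ('i \<Rightarrow> complex mat) \<Rightarrow> 'i set \<Rightarrow> complex mat" where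
  "mat_sum n F I = mat n n (\<lambda>(i, j). \<Sum>k\<in>I. F k $$ (i, j))"

text \<open>Tensor product of operators in the basis of \<open>\<complex>\<^sup>k \<otimes> \<complex>\<^sup>l\<close> that puts \<open>e\<^sub>i \<otimes> e\<^sub>j\<close> at position \<open>i * l + j\<close>.\<close>

definition kron :: "complex mat \<Rightarrow> complex mat \<Rightarrow> complex mat" where
  "kron A B = mat (dim_row A * dim_row B) (dim_col A * dim_col B)
     (\<lambda>(i, j). A $$ (i div dim_row B, j div dim_col B) * B $$ (i mod dim_row B, j mod dim_col B))"

definition density_operator :: "nat \<Rightarrow> complex mat \<Rightarrow> bool" where
  "density_operator n \<rho> \<longleftrightarrow> psd n \<rho> \<and> mat_trace \<rho> = 1"

definition povm :: "nat \<Rightarrow> nat \<Rightarrow> (nat \<Rightarrow> complex mat) \<Rightarrow> bool" where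
  "povm n d M \<longleftrightarrow> (\<forall>a<d. psd n (M a)) \<and> mat_sum n M {..<d} = 1\<^sub>m n"

text \<open>A family \<open>M\<close> of POVMs has elements \<open>M x a\<close> with setting \<open>x\<close> and outcome \<open>a\<close>. In \<open>compatible\<close>,
  \<open>r a x l\<close> stands for \<open>p(a|x,\<lambda>)\<close>, and \<open>k\<close> is the number of outcomes of the parent POVM \<open>G\<close>.\<close>

definition compatible :: "nat \<Rightarrow> nat \<Rightarrow> (nat \<Rightarrow> nat \<Rightarrow> complex mat) \<Rightarrow> nat set \<Rightarrow> bool" where
  "compatible n d M S \<longleftrightarrow>
     (\<exists>k G. \<exists>r :: nat \<Rightarrow> nat \<Rightarrow> nat \<Rightarrow> real.
        povm n k G \<and>
        (\<forall>x\<in>S. \<forall>l<k. (\<forall>a<d. 0 \<le> r a x l) \<and> (\<Sum>a<d. r a x l) = 1) \<and>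
        (\<forall>x\<in>S. \<forall>a<d. M x a = mat_sum n (\<lambda>l. complex_of_real (r a x l) \<cdot>\<^sub>m G l) {..<k}))"

definition compatibility_structure ::
    "nat \<Rightarrow> nat \<Rightarrow> nat \<Rightarrow> (nat \<Rightarrow> nat \<Rightarrow> complex mat) \<Rightarrow> nat set set" where
  "compatibility_structure n m d M = {S. S \<subseteq> {1..m} \<and> compatible n d M S}"

definition star_graph :: "nat \<Rightarrow> nat \<Rightarrow> nat set set" where
  "star_graph m c = {{c, x} | x. x \<in> {1..m} \<and> x \<noteq> c}"

text \<open>\<open>p a b x y\<close> stands for \<open>p(ab|xy)\<close>. Only the values with \<open>a, b < d\<close> and \<open>x, y \<in> {1..m}\<close> are
  meaningful; all notions below ignore the others.\<close>

type_synonym behavior = "nat \<Rightarrow> nat \<Rightarrow> nat \<Rightarrow> nat \<Rightarrow> real"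

definition realizes ::
    "nat \<Rightarrow> nat \<Rightarrow> nat \<Rightarrow> nat \<Rightarrow> (nat \<Rightarrow> nat \<Rightarrow> complex mat) \<Rightarrow> (nat \<Rightarrow> nat \<Rightarrow> complex mat) \<Rightarrow>
      complex mat \<Rightarrow> behavior \<Rightarrow> bool" where
  "realizes m d nA nB M N \<rho> p \<longleftrightarrow>
     density_operator (nA * nB) \<rho> \<and>
     (\<forall>x\<in>{1..m}. povm nA d (M x)) \<and>
     (\<forall>y\<in>{1..m}. povm nB d (N y)) \<and>
     (\<forall>a<d. \<forall>b<d. \<forall>x\<in>{1..m}. \<forall>y\<in>{1..m}.
        complex_of_real (p a b x y) = mat_trace (kron (M x a) (N y b) * \<rho>))"

definition quantum_set :: "nat \<Rightarrow> nat \<Rightarrow> behavior set" where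
  "quantum_set m d = {p. \<exists>nA nB M N \<rho>. realizes m d nA nB M N \<rho> p}"

definition unnormalized_quantum_set :: "nat \<Rightarrow> nat \<Rightarrow> behavior set" where
  "unnormalized_quantum_set m d =
     {q. \<exists>c\<ge>0. \<exists>p\<in>quantum_set m d.
           \<forall>a<d. \<forall>b<d. \<forall>x\<in>{1..m}. \<forall>y\<in>{1..m}. q a b x y = c * p a b x y}"

text \<open>The set of behaviors written \<open>\<R>\<^sup>N\<^sup>L\<close> with settings \<open>xs\<close>, \<open>ys\<close> for \<open>x\<^sup>*\<close>, \<open>y\<^sup>*\<close>.\<close>

definition R_NL :: "nat \<Rightarrow> nat \<Rightarrow> nat \<Rightarrow> nat \<Rightarrow> behavior set" where
  "R_NL m d xs ys =
     {p. \<exists>nA nB M N \<rho>. realizes m d nA nB M N \<rho> p \<and>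
           star_graph m xs \<subseteq> compatibility_structure nA m d M \<and>
           star_graph m ys \<subseteq> compatibility_structure nB m d N}"

text \<open>\<open>P e e'\<close> is the unnormalized behavior \<open>p\<^sup>e\<^sup>e\<^sup>'\<close>.\<close>

definition feasible :: "nat \<Rightarrow> nat \<Rightarrow> behavior \<Rightarrow> (nat \<Rightarrow> nat \<Rightarrow> behavior) \<Rightarrow> bool" where
  "feasible m d pobs P \<longleftrightarrow>
     (\<forall>e<d. \<forall>e'<d. P e e' \<in> unnormalized_quantum_set m d) \<and>
     (\<forall>a<d. \<forall>b<d. \<forall>x\<in>{1..m}. \<forall>y\<in>{1..m}.
        (\<Sum>e<d. \<Sum>e'<d. P e e' a b x y) = pobs a b x y)"

definition guess_values :: "nat \<Rightarrow> nat \<Rightarrow> behavior \<Rightarrow> nat \<Rightarrow> nat \<Rightarrow> real set" where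
  "guess_values m d pobs xs ys =
     {(\<Sum>e<d. \<Sum>e'<d. P e e' e e' xs ys) | P. feasible m d pobs P}"

text \<open>The guessing probability is the maximum of \<open>guess_values\<close>. The set of finite-dimensional
  quantum behaviors is not closed in general, so a maximum need not be attained, and taking the
  supremum instead would turn an unattained value 1 into guessing probability 1. \<open>P_guess_NL < c\<close>
  is therefore rendered as what it means for a maximum: every attained value is below \<open>c\<close>. As no
  value exceeds 1, for \<open>c = 1\<close> it says exactly that no feasible family attains 1.\<close>

definition P_guess_NL_less ::
    "nat \<Rightarrow> nat \<Rightarrow> behavior \<Rightarrow> nat \<Rightarrow> nat \<Rightarrow> real \<Rightarrow> bool" where
  "P_guess_NL_less m d pobs xs ys c \<longleftrightarrow> (\<forall>v \<in> guess_values m d pobs xs ys. v < c)"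

end

theory Submission
  imports Defs
begin

text \<open>If the pairs \<open>{x\<^sup>*, x}\<close> are compatible, each pair has a joint POVM \<open>G\<^sub>x(e, a)\<close>. The effects
  \<open>G\<^sub>x(e, \<cdot>)\<close> sum to \<open>M(e|x\<^sup>*)\<close> for every \<open>x\<close>, so for a fixed guess they form subnormalized POVMs with a
  common total. Moving this total (on both sides) into the state gives an unnormalized quantum
  behavior, and these behaviors for all pairs of guesses attain the value 1.

  Conversely, if the value is 1, every normalized component of nonzero weight gives outcomes \<open>(e, e')\<close>
  with certainty at \<open>(x\<^sup>*, y\<^sup>*)\<close>. By no-signalling the POVMs \<open>x\<^sup>*\<close> and \<open>y\<^sup>*\<close> can then be
  replaced by deterministic ones, which are compatible with anything, and block-diagonal direct sums
  show that the resulting set of behaviors is convex.\<close>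

section \<open>Positive semidefinite matrices\<close>


text \<open>The total effect \<open>K\<close> of a guess may be singular, and neither its
  eigenvectors nor its square root are ever computed. Gram-Schmidt is run instead on the possibly
  degenerate form of \<open>K\<close>. It yields a rectangular \<open>V\<close> with
  \<open>adj V * V = K\<close>, so the conditional behavior of a guess lives on a space whose
  dimension is the rank of \<open>K\<close>, where the normalized effects sum exactly to the
  identity.

  In the converse direction the given POVMs at the two guessed settings need not be deterministic,
  nor compatible with the others: certainty of an outcome constrains them only through the given
  state. Replacing them is sound because certainty makes each joint distribution involving a guessed
  setting a point mass times the partner's marginal, and this marginal does not depend on the
  setting that was changed.

  The components for different guesses come with unrelated spaces and states. As the dimension is
  unbounded, all of them can be placed in one local space per party, and a parent POVM of a direct
  sum is assembled from parents of the summands.\<close>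

definition adj :: "complex mat \<Rightarrow> complex mat" where
  "adj A = mat (dim_col A) (dim_row A) (\<lambda>(i, j). cnj (A $$ (j, i)))"

lemma adj_carrier [simp, intro]: "A \<in> carrier_mat n m \<Longrightarrow> adj A \<in> carrier_mat m n"
  by (auto simp: adj_def)

lemma dim_adj [simp]: "dim_row (adj A) = dim_col A" "dim_col (adj A) = dim_row A"
  by (auto simp: adj_def)

lemma adj_index [simp]: "i < dim_col A \<Longrightarrow> j < dim_row A \<Longrightarrow> adj A $$ (i, j) = cnj (A $$ (j, i))"
  by (auto simp: adj_def)

lemma adj_adj [simp]: "adj (adj A) = A"
  by (rule eq_matI) auto

lemma adj_mult: "A \<in> carrier_mat n m \<Longrightarrow> B \<in> carrier_mat m l \<Longrightarrow> adj (A * B) = adj B * adj A"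
  by (rule eq_matI) (auto simp: scalar_prod_def mult.commute intro!: sum.cong)

lemma cscalar_prod_adj:
  assumes W: "W \<in> carrier_mat n r" and x: "x \<in> carrier_vec n" and y: "y \<in> carrier_vec r"
  shows "(adj W *\<^sub>v x) \<bullet>c y = x \<bullet>c (W *\<^sub>v y)"
proof -
  have "(adj W *\<^sub>v x) \<bullet>c y = (\<Sum>i<r. \<Sum>k<n. cnj (W $$ (k, i)) * x $ k * cnj (y $ i))"
    using W x y by (auto simp: scalar_prod_def lessThan_atLeast0 sum_distrib_right intro!: sum.cong)
  also have "\<dots> = (\<Sum>k<n. \<Sum>i<r. cnj (W $$ (k, i)) * x $ k * cnj (y $ i))"
    by (rule sum.swap)
  also have "\<dots> = x \<bullet>c (W *\<^sub>v y)"
    using W x y by (auto simp: scalar_prod_def lessThan_atLeast0 sum_distrib_left intro!: sum.cong)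
  finally show ?thesis .
qed

lemma psd_carrier: "psd n A \<Longrightarrow> A \<in> carrier_mat n n"
  by (simp add: psd_def)

lemma psd_congruence:
  assumes "psd n K" and W: "W \<in> carrier_mat n r"
  shows "psd r (adj W * K * W)"
proof -
  have K: "K \<in> carrier_mat n n" using assms(1) by (rule psd_carrier)
  have "0 \<le> (adj W * K * W *\<^sub>v v) \<bullet>c v" if v: "v \<in> carrier_vec r" for v
  proof -
    have "adj W * K * W *\<^sub>v v = adj W *\<^sub>v (K *\<^sub>v (W *\<^sub>v v))"
      using K W v assoc_mult_mat_vec[of "adj W * K" r n W r v]
        assoc_mult_mat_vec[of "adj W" r n K n "W *\<^sub>v v"]
      by (metis adj_carrier mult_carrier_mat mult_mat_vec_carrier)
    then have "(adj W * K * W *\<^sub>v v) \<bullet>c v = (K *\<^sub>v (W *\<^sub>v v)) \<bullet>c (W *\<^sub>v v)"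
      using K W v by (simp add: cscalar_prod_adj[of W n r])
    then show ?thesis
      using assms(1) W v unfolding psd_def by auto
  qed
  then show ?thesis using K W by (auto simp: psd_def)
qed

text \<open>This is the inner product of \<open>A f\<close> with \<open>g\<close>, linear in
  \<open>f\<close> and conjugate-linear in \<open>g\<close>. Vectors are plain functions, so
  sesquilinearity holds without carrier conditions; values at indices from \<open>n\<close> on are
  ignored.\<close>

definition qform :: "nat \<Rightarrow> complex mat \<Rightarrow> (nat \<Rightarrow> complex) \<Rightarrow> (nat \<Rightarrow> complex) \<Rightarrow> complex" where
  "qform n A f g = (\<Sum>i<n. \<Sum>j<n. cnj (g i) * A $$ (i, j) * f j)"

lemma psd_iff_qform:
  assumes A: "A \<in> carrier_mat n n"
  shows "psd n A \<longleftrightarrow> (\<forall>f. 0 \<le> qform n A f f)"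
proof -
  have eq: "(A *\<^sub>v v) \<bullet>c v = qform n A (($) v) (($) v)" if "v \<in> carrier_vec n" for v
    using A that by (auto simp: qform_def scalar_prod_def lessThan_atLeast0 sum_distrib_left
        sum_distrib_right ac_simps intro!: sum.cong)
  have "qform n A f f = (A *\<^sub>v vec n f) \<bullet>c vec n f" for f
    by (subst eq) (auto simp: qform_def)
  then have "0 \<le> qform n A f f" if "psd n A" for f
    using that by (simp add: psd_def)
  then show ?thesis
    using A eq by (auto simp: psd_def)
qed

lemma qform_add_left: "qform n A (\<lambda>i. f i + f' i) g = qform n A f g + qform n A f' g"
  by (simp add: qform_def algebra_simps sum.distrib)

lemma qform_add_right: "qform n A f (\<lambda>i. g i + g' i) = qform n A f g + qform n A f g'"
  by (simp add: qform_def algebra_simps sum.distrib)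

lemma qform_diff_left: "qform n A (\<lambda>i. f i - f' i) g = qform n A f g - qform n A f' g"
  by (simp add: qform_def algebra_simps sum_subtractf)

lemma qform_diff_right: "qform n A f (\<lambda>i. g i - g' i) = qform n A f g - qform n A f g'"
  by (simp add: qform_def algebra_simps sum_subtractf)

lemma qform_scale_left: "qform n A (\<lambda>i. c * f i) g = c * qform n A f g"
  by (simp add: qform_def algebra_simps sum_distrib_left)

lemma qform_scale_right: "qform n A f (\<lambda>i. c * g i) = cnj c * qform n A f g"
  by (simp add: qform_def algebra_simps sum_distrib_left)

lemma qform_sum_left:
  "finite I \<Longrightarrow> qform n A (\<lambda>i. \<Sum>k\<in>I. f k i) g = (\<Sum>k\<in>I. qform n A (f k) g)"
proof (induction I rule: finite_induct)
  case empty
  show ?case by (simp add: qform_def)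
qed (simp add: qform_add_left)

lemmas qform_linear = qform_add_left qform_add_right qform_diff_left qform_diff_right
  qform_scale_left qform_scale_right

text \<open>Polarization: the form is real at \<open>f\<close>, \<open>g\<close>,
  \<open>f + g\<close> and \<open>f + \<i> g\<close>. The third value forces the imaginary parts of
  the two cross terms to cancel, the fourth makes their real parts equal.\<close>

lemma qform_commute:
  assumes "psd n A"
  shows "qform n A g f = cnj (qform n A f g)"
proof -
  have pos: "0 \<le> qform n A h h" for h
    using assms psd_carrier psd_iff_qform by blast
  have "Im (qform n A f g + qform n A g f) = 0"
    using pos[of "\<lambda>i. f i + g i"] pos[of f] pos[of g]
    by (simp add: qform_linear less_eq_complex_def)
  moreover have "Im (qform n A (\<lambda>i. f i + \<i> * g i) (\<lambda>i. f i + \<i> * g i)) = 0"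
    using pos[of "\<lambda>i. f i + \<i> * g i"] by (simp only: less_eq_complex_def) simp
  then have "Re (qform n A f g) = Re (qform n A g f)"
    using pos[of f] pos[of g] by (simp add: qform_linear less_eq_complex_def)
  ultimately show ?thesis
    by (simp add: complex_eq_iff)
qed

lemma qform_entry:
  assumes "i < n" "j < n"
  shows "qform n A (\<lambda>k. of_bool (k = j)) (\<lambda>k. of_bool (k = i)) = A $$ (i, j)"
proof -
  have "qform n A (\<lambda>k. of_bool (k = j)) (\<lambda>k. of_bool (k = i))
      = (\<Sum>k<n. if k = i then \<Sum>l<n. if l = j then A $$ (k, l) else 0 else 0)"
    unfolding qform_def by (intro sum.cong) (auto intro!: sum.cong sum.neutral)
  then show ?thesis using assms by simp
qed

lemma psd_hermitian:
  assumes "psd n A"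
  shows "adj A = A"
proof (rule eq_matI)
  have A: "A \<in> carrier_mat n n" using assms by (rule psd_carrier)
  then show "dim_row (adj A) = dim_row A" "dim_col (adj A) = dim_col A" by auto
  fix i j
  assume "i < dim_row A" "j < dim_col A"
  then show "adj A $$ (i, j) = A $$ (i, j)"
    using A qform_entry[of i n j A] qform_entry[of j n i A]
      qform_commute[OF assms, of "\<lambda>k. of_bool (k = j)" "\<lambda>k. of_bool (k = i)"]
    by simp
qed

text \<open>A variational form of Cauchy-Schwarz. With \<open>h = A f\<close> and \<open>S\<close>
  the squared norm of \<open>h\<close>, the form at \<open>f - s h\<close> equals
  \<open>s (s T - 2 S)\<close>, which would be negative for small positive \<open>s\<close> if
  \<open>S\<close> were positive.\<close>

lemma psd_null:
  assumes "psd n A" and null: "qform n A f f = 0" and "i < n"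
  shows "(\<Sum>j<n. A $$ (i, j) * f j) = 0"
proof -
  define h where "h = (\<lambda>i. \<Sum>j<n. A $$ (i, j) * f j)"
  define S where "S = (\<Sum>i<n. (cmod (h i))\<^sup>2)"
  have fh: "qform n A f h = of_real S"
    unfolding qform_def S_def of_real_sum
    by (rule sum.cong) (simp_all only: complex_norm_square mult.assoc
        mult.commute[of _ "cnj _"] h_def flip: sum_distrib_left)
  have hf: "qform n A h f = of_real S"
    by (subst qform_commute[OF assms(1)]) (simp add: fh)
  have pos: "0 \<le> qform n A g g" for g
    using assms psd_carrier psd_iff_qform by blast
  define T where "T = Re (qform n A h h)"
  have T: "0 \<le> T" using pos[of h] by (simp add: T_def less_eq_complex_def)
  have ineq: "0 \<le> s * (s * T - 2 * S)" for s :: real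
  proof -
    have "0 \<le> Re (qform n A (\<lambda>i. f i - of_real s * h i) (\<lambda>i. f i - of_real s * h i))"
      using pos by (simp add: less_eq_complex_def)
    then show ?thesis
      by (simp add: qform_linear null fh hf T_def algebra_simps)
  qed
  have "S \<le> 0"
  proof (rule ccontr)
    assume "\<not> S \<le> 0"
    \<comment> \<open>The choice \<open>s = S / (T + 1)\<close> makes \<open>s T < S\<close>; the
      \<open>+ 1\<close> covers \<open>T = 0\<close>.\<close>
    then have "S / (T + 1) * (S / (T + 1) * T - 2 * S) < 0"
      using T by (intro mult_pos_neg) (auto simp: field_simps add_pos_nonneg
          intro: order.strict_trans1[of _ 0])
    then show False using ineq[of "S / (T + 1)"] by linarith
  qed
  then have "\<forall>i\<in>{..<n}. (cmod (h i))\<^sup>2 = 0"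
    unfolding S_def using sum_nonneg_eq_0_iff[of "{..<n}" "\<lambda>i. (cmod (h i))\<^sup>2"]
    by (simp add: antisym sum_nonneg)
  then show ?thesis using \<open>i < n\<close> by (auto simp: h_def)
qed

text \<open>Gram-Schmidt for the semi-inner product of \<open>K\<close>. A remainder of positive
  length is normalized and joins the family \<open>w\<close>; a remainder of length zero need not be
  the zero vector, so each \<open>e j\<close> is expanded only up to a null vector
  \<open>u\<close>.\<close>

lemma psd_orthonormal:
  fixes e :: "nat \<Rightarrow> nat \<Rightarrow> complex"
  assumes "psd n K"
  shows "\<exists>(r::nat) (w :: nat \<Rightarrow> nat \<Rightarrow> complex). (\<forall>k<r. \<forall>l<r. qform n K (w k) (w l) = of_bool (k = l)) \<and>
    (\<forall>j<m. \<exists>u. qform n K u u = 0 \<and>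
       (\<forall>i. e j i = (\<Sum>k<r. qform n K (e j) (w k) * w k i) + u i))"
proof (induction m)
  case 0
  show ?case by (rule exI[of _ "0::nat"]) simp
next
  case (Suc m)
  have pos: "0 \<le> qform n K h h" for h
    using assms psd_carrier psd_iff_qform by blast
  from Suc obtain r :: nat and w where
    on: "\<And>k l. k < r \<Longrightarrow> l < r \<Longrightarrow> qform n K (w k) (w l) = of_bool (k = l)" and
    span: "\<And>j. j < m \<Longrightarrow> \<exists>u. qform n K u u = 0 \<and>
       (\<forall>i. e j i = (\<Sum>k<r. qform n K (e j) (w k) * w k i) + u i)"
    by blast
  define u where "u i = e m i - (\<Sum>k<r. qform n K (e m) (w k) * w k i)" for i
  have uw: "qform n K u (w l) = 0" if "l < r" for l
    using that by (simp add: u_def[abs_def] qform_linear qform_sum_left on of_bool_def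
        if_distrib if_distribR cong: if_cong)
  show ?case
  proof (cases "qform n K u u = 0")
    case True
    have "\<exists>u. qform n K u u = 0 \<and>
       (\<forall>i. e j i = (\<Sum>k<r. qform n K (e j) (w k) * w k i) + u i)" if "j < Suc m" for j
      using span[of j] that True by (cases "j = m") (auto simp: u_def intro!: exI[of _ u])
    then show ?thesis using on by blast
  next
    case False
    \<comment> \<open>The length of the remainder in the form of \<open>K\<close>, real and nonzero
      in this case.\<close>
    define s where "s = complex_of_real (sqrt (Re (qform n K u u)))"
    have s2: "s * s = qform n K u u"
      using pos[of u] by (auto simp: s_def complex_eq_iff less_eq_complex_def)
    have s0: "s \<noteq> 0" and cs: "cnj s = s" using False s2 by (auto simp: s_def)
    define z where "z = (\<lambda>i. inverse s * u i)"
    have uz: "qform n K u z = s"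
      unfolding z_def qform_scale_right using s0 by (simp add: cs flip: s2)
    have zz: "qform n K z z = 1"
      using s0 by (subst (1) z_def) (simp add: qform_linear uz)
    have zw: "qform n K z (w l) = 0" if "l < r" for l
      using uw[OF that] by (simp add: z_def qform_linear)
    have wz: "qform n K (w l) z = 0" if "l < r" for l
      using zw[OF that] by (subst qform_commute[OF assms]) simp
    define w' where "w' = w(r := z)"
    have "qform n K (w' k) (w' l) = of_bool (k = l)" if "k < Suc r" "l < Suc r" for k l
      using that on zz zw wz by (auto simp: w'_def less_Suc_eq)
    moreover have "\<exists>u. qform n K u u = 0 \<and>
        (\<forall>i. e j i = (\<Sum>k<Suc r. qform n K (e j) (w' k) * w' k i) + u i)"
      if "j < Suc m" for j
    proof (cases "j = m")
      case True
      have "qform n K (e m) z = qform n K (\<lambda>i. u i + (\<Sum>k<r. qform n K (e m) (w k) * w k i)) z"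
        by (simp add: u_def)
      also have "\<dots> = s"
        by (simp add: qform_linear qform_sum_left uz wz)
      finally have ez: "qform n K (e m) z = s" .
      have zi: "qform n K (e m) z * z i = u i" for i
        unfolding ez using s0 by (simp add: z_def)
      have q0: "qform n K (\<lambda>_. 0) (\<lambda>_. 0) = 0"
        by (simp add: qform_def)
      show ?thesis
        using True s0
        by (intro exI[of _ "\<lambda>_. 0"]; auto simp: w'_def zi q0; simp add: u_def)
    next
      case False
      then have "j < m" using that by simp
      from span[OF this] obtain v where v: "qform n K v v = 0"
        and ej: "\<And>i. e j i = (\<Sum>k<r. qform n K (e j) (w k) * w k i) + v i" by blast
      \<comment> \<open>\<open>K\<close> annihilates the null vector \<open>v\<close>, so the new
        direction \<open>z\<close> does not change the expansions found earlier.\<close>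
      have "qform n K v z = 0"
        using psd_null[OF assms v]
        by (simp add: qform_def mult.assoc flip: sum_distrib_left)
      moreover have "qform n K (e j) z
          = qform n K (\<lambda>i. (\<Sum>k<r. qform n K (e j) (w k) * w k i) + v i) z"
        by (intro arg_cong[of _ _ "\<lambda>h. qform n K h z"] ext ej)
      ultimately have "qform n K (e j) z = 0"
        by (simp only: qform_linear) (simp add: qform_linear qform_sum_left wz)
      then show ?thesis
        using v ej by (intro exI[of _ v]) (auto simp: w'_def)
    qed
    ultimately show ?thesis by blast
  qed
qed


text \<open>The columns of \<open>W\<close> are the \<open>K\<close>-orthonormal vectors of
  Gram-Schmidt, so \<open>W * adj W\<close> acts as a generalized inverse of \<open>K\<close>. The
  product \<open>W * (adj W * K)\<close> differs from the identity only by null vectors of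
  \<open>K\<close>, and every \<open>G\<close> that vanishes on these absorbs it.\<close>

lemma psd_compression:
  assumes K: "psd n K"
  obtains r W where "W \<in> carrier_mat n r" "adj W * K * W = 1\<^sub>m r"
    "\<And>G. psd n G \<Longrightarrow> (\<And>f. qform n K f f = 0 \<Longrightarrow> qform n G f f = 0) \<Longrightarrow> G * (W * (adj W * K)) = G"
proof -
  have Kc: "K \<in> carrier_mat n n" using K by (rule psd_carrier)
  \<comment> \<open>The standard basis: Gram-Schmidt applied to it reaches every column
    index.\<close>
  define e :: "nat \<Rightarrow> nat \<Rightarrow> complex" where "e j i = of_bool (i = j)" for j i
  obtain r :: nat and w where
    on: "\<And>k l. k < r \<Longrightarrow> l < r \<Longrightarrow> qform n K (w k) (w l) = of_bool (k = l)" and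
    span: "\<And>j. j < n \<Longrightarrow> \<exists>u. qform n K u u = 0 \<and>
       (\<forall>i. e j i = (\<Sum>k<r. qform n K (e j) (w k) * w k i) + u i)"
    using psd_orthonormal[OF K, of n e] by blast
  define W where "W = mat n r (\<lambda>(i, k). w k i)"
  have W: "W \<in> carrier_mat n r" by (simp add: W_def)
  have WK: "(adj W * K) $$ (k, j) = qform n K (e j) (w k)" if "k < r" "j < n" for k j
  proof -
    have "qform n K (e j) (w k) = (\<Sum>i<n. \<Sum>l<n. if l = j then cnj (w k i) * K $$ (i, l) else 0)"
      unfolding qform_def by (intro sum.cong) (auto simp: e_def)
    also have "\<dots> = (\<Sum>i<n. cnj (w k i) * K $$ (i, j))"
      using that by simp
    finally show ?thesis
      using that Kc W by (simp add: scalar_prod_def lessThan_atLeast0 W_def)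
  qed
  have "adj W * K * W = 1\<^sub>m r"
  proof (rule eq_matI)
    fix i j assume "i < dim_row (1\<^sub>m r :: complex mat)" "j < dim_col (1\<^sub>m r :: complex mat)"
    then have ij: "i < r" "j < r" by auto
    have "(adj W * K * W) $$ (i, j) = (\<Sum>l<n. (adj W * K) $$ (i, l) * w j l)"
      using ij Kc W by (simp add: scalar_prod_def lessThan_atLeast0 W_def)
    also have "\<dots> = (\<Sum>l<n. (\<Sum>k<n. cnj (w i k) * K $$ (k, l)) * w j l)"
      using ij Kc W by (intro sum.cong) (simp_all add: scalar_prod_def lessThan_atLeast0 W_def)
    also have "\<dots> = qform n K (w j) (w i)"
      unfolding qform_def by (subst sum.swap) (simp add: sum_distrib_right)
    finally show "(adj W * K * W) $$ (i, j) = 1\<^sub>m r $$ (i, j)"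
      using ij on by auto
  qed (use W in auto)
  moreover have "G * (W * (adj W * K)) = G"
    if G: "psd n G" and null: "\<And>f. qform n K f f = 0 \<Longrightarrow> qform n G f f = 0" for G
  proof (rule eq_matI)
    have Gc: "G \<in> carrier_mat n n" using G by (rule psd_carrier)
    fix i j assume "i < dim_row G" "j < dim_col G"
    then have ij: "i < n" "j < n" using Gc by auto
    obtain u where u: "qform n K u u = 0"
      and ej: "\<And>i. e j i = (\<Sum>k<r. qform n K (e j) (w k) * w k i) + u i"
      using span[OF ij(2)] by blast
    \<comment> \<open>Column \<open>j\<close> of the product is the \<open>K\<close>-projection of
      the basis vector \<open>e j\<close>, that is, \<open>e j\<close> without its null
      remainder.\<close>
    have WWK: "(W * (adj W * K)) $$ (l, j) = e j l - u l" if "l < n" for l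
    proof -
      have "(W * (adj W * K)) $$ (l, j) = (\<Sum>k<r. w k l * (adj W * K) $$ (k, j))"
        using that ij Kc W by (simp add: scalar_prod_def lessThan_atLeast0 W_def)
      also have "\<dots> = e j l - u l"
        using ij by (simp add: ej[of l] WK mult.commute)
      finally show ?thesis .
    qed
    have "(G * (W * (adj W * K))) $$ (i, j) = (\<Sum>l<n. G $$ (i, l) * (W * (adj W * K)) $$ (l, j))"
      using ij Gc Kc W by (simp add: scalar_prod_def lessThan_atLeast0 del: index_mult_mat(1))
        (simp add: scalar_prod_def lessThan_atLeast0)
    also have "\<dots> = (\<Sum>l<n. G $$ (i, l) * e j l) - (\<Sum>l<n. G $$ (i, l) * u l)"
      by (simp add: WWK algebra_simps sum_subtractf)
    also have "\<dots> = G $$ (i, j)"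
      using psd_null[OF G null[OF u] ij(1)] ij by (simp add: e_def of_bool_def if_distrib cong: if_cong)
    finally show "(G * (W * (adj W * K))) $$ (i, j) = G $$ (i, j)" .
  qed (use psd_carrier[OF that(1)] Kc W in auto)
  ultimately show ?thesis using that W by blast
qed

section \<open>Sums, tensor products and traces\<close>

lemma mat_sum_carrier [simp, intro]: "mat_sum n F I \<in> carrier_mat n n"
  by (simp add: mat_sum_def)

lemma mat_sum_index [simp]: "i < n \<Longrightarrow> j < n \<Longrightarrow> mat_sum n F I $$ (i, j) = (\<Sum>k\<in>I. F k $$ (i, j))"
  by (simp add: mat_sum_def)

lemma dim_mat_sum [simp]: "dim_row (mat_sum n F I) = n" "dim_col (mat_sum n F I) = n"
  by (simp_all add: mat_sum_def)

lemma mat_sum_cong: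
  "(\<And>k. k \<in> I \<Longrightarrow> F k = F' k) \<Longrightarrow> mat_sum n F I = mat_sum n F' I"
  by (rule eq_matI) auto

lemma mat_sum_mult:
  assumes "A \<in> carrier_mat r n" "B \<in> carrier_mat n r" "\<And>k. k \<in> I \<Longrightarrow> F k \<in> carrier_mat n n"
  shows "A * mat_sum n F I * B = mat_sum r (\<lambda>k. A * F k * B) I"
proof (rule eq_matI)
  have gen: "(A * X * B) $$ (i, j) = (\<Sum>l<n. \<Sum>m<n. A $$ (i, m) * X $$ (m, l) * B $$ (l, j))"
    if "X \<in> carrier_mat n n" "i < r" "j < r" for X i j
  proof -
    show ?thesis
      using that assms(1,2) unfolding times_mat_def
      by (simp add: scalar_prod_def lessThan_atLeast0 sum_distrib_right)
  qed
  fix i j assume "i < dim_row (mat_sum r (\<lambda>k. A * F k * B) I)" "j < dim_col (mat_sum r (\<lambda>k. A * F k * B) I)"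
  then have ij: "i < r" "j < r" by auto
  have "(A * mat_sum n F I * B) $$ (i, j)
      = (\<Sum>l<n. \<Sum>m<n. \<Sum>k\<in>I. A $$ (i, m) * F k $$ (m, l) * B $$ (l, j))"
    by (simp add: gen[OF mat_sum_carrier ij] sum_distrib_left sum_distrib_right)
  also have "\<dots> = (\<Sum>l<n. \<Sum>k\<in>I. \<Sum>m<n. A $$ (i, m) * F k $$ (m, l) * B $$ (l, j))"
    by (rule sum.cong[OF refl], rule sum.swap)
  also have "\<dots> = (\<Sum>k\<in>I. \<Sum>l<n. \<Sum>m<n. A $$ (i, m) * F k $$ (m, l) * B $$ (l, j))"
    by (rule sum.swap)
  also have "\<dots> = mat_sum r (\<lambda>k. A * F k * B) I $$ (i, j)"
    using ij by (simp add: gen[OF assms(3) ij] del: index_mult_mat)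
  finally show "(A * mat_sum n F I * B) $$ (i, j) = mat_sum r (\<lambda>k. A * F k * B) I $$ (i, j)" .
qed (use assms in auto)

lemma qform_mat_sum: "qform n (mat_sum n F I) f g = (\<Sum>k\<in>I. qform n (F k) f g)"
proof -
  have "qform n (mat_sum n F I) f g
      = (\<Sum>i<n. \<Sum>j<n. \<Sum>k\<in>I. cnj (g i) * F k $$ (i, j) * f j)"
    by (simp add: qform_def sum_distrib_left sum_distrib_right)
  also have "\<dots> = (\<Sum>i<n. \<Sum>k\<in>I. \<Sum>j<n. cnj (g i) * F k $$ (i, j) * f j)"
    by (rule sum.cong[OF refl], rule sum.swap)
  also have "\<dots> = (\<Sum>k\<in>I. \<Sum>i<n. \<Sum>j<n. cnj (g i) * F k $$ (i, j) * f j)"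
    by (rule sum.swap)
  finally show ?thesis by (simp add: qform_def)
qed

lemma psd_qform: "psd n A \<Longrightarrow> 0 \<le> qform n A f f"
  using psd_carrier psd_iff_qform by blast

lemma psd_mat_sum: "(\<And>k. k \<in> I \<Longrightarrow> psd n (F k)) \<Longrightarrow> psd n (mat_sum n F I)"
  by (simp add: psd_iff_qform qform_mat_sum psd_qform sum_nonneg)

lemma qform_smult: "A \<in> carrier_mat n n \<Longrightarrow> qform n (c \<cdot>\<^sub>m A) f g = c * qform n A f g"
  by (simp add: qform_def sum_distrib_left ac_simps)

lemma psd_smult: "psd n A \<Longrightarrow> 0 \<le> c \<Longrightarrow> psd n (complex_of_real c \<cdot>\<^sub>m A)"
  by (frule psd_carrier) (auto simp: psd_iff_qform qform_smult less_eq_complex_def)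

lemma qform_add_mat:
  "A \<in> carrier_mat n n \<Longrightarrow> B \<in> carrier_mat n n \<Longrightarrow> qform n (A + B) f g = qform n A f g + qform n B f g"
  by (simp add: qform_def algebra_simps sum.distrib)

lemma psd_add: "psd n A \<Longrightarrow> psd n B \<Longrightarrow> psd n (A + B)"
  using psd_carrier[of n A] psd_carrier[of n B]
  by (auto simp: psd_iff_qform qform_add_mat)

lemma psd_zero: "psd n (0\<^sub>m n n)"
  by (simp add: psd_iff_qform qform_def)

lemma psd_one: "psd n (1\<^sub>m n)"
proof -
  have "qform n (1\<^sub>m n) f f = (\<Sum>i<n. cnj (f i) * f i)" for f
  proof -
    have "qform n (1\<^sub>m n) f f = (\<Sum>i<n. \<Sum>j<n. if j = i then cnj (f i) * f j else 0)"
      unfolding qform_def by (intro sum.cong) auto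
    then show ?thesis by simp
  qed
  then show ?thesis
    by (simp add: psd_iff_qform sum_nonneg less_eq_complex_def mult.commute)
qed

text \<open>With \<open>V = adj W * K\<close> from the compression, \<open>adj V * V\<close> is
  \<open>K * W * adj W * K\<close>, and \<open>K\<close> absorbs the last three factors because it
  vanishes on its own null vectors.\<close>

lemma psd_factor:
  assumes "psd n K"
  obtains r V where "V \<in> carrier_mat r n" "K = adj V * V"
proof -
  obtain r W where W: "W \<in> carrier_mat n r" "K * (W * (adj W * K)) = K"
    using psd_compression[OF assms] assms by metis
  have K: "K \<in> carrier_mat n n" using assms by (rule psd_carrier)
  have "adj (adj W * K) = K * W"
    using W K psd_hermitian[OF assms] by (simp add: adj_mult[of _ r n _ n])
  then have "adj (adj W * K) * (adj W * K) = K"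
    using W K by (metis adj_carrier assoc_mult_mat mult_carrier_mat)
  then show ?thesis
    using that[of "adj W * K" r] W K by (metis adj_carrier mult_carrier_mat)
qed


section \<open>Kronecker products\<close>

lemma sum_div_mod: "(\<Sum>k<a * b. f (k div b) (k mod b)) = (\<Sum>i<a. \<Sum>j<b. f i (j::nat))"
proof (cases "b = 0")
  case False
  have "(\<Sum>k<a * b. f (k div b) (k mod b)) = (\<Sum>i<a. sum (\<lambda>k. f (k div b) (k mod b)) {i * b..<i * b + b})"
    by (rule sum.nat_group[symmetric])
  also have "\<dots> = (\<Sum>i<a. \<Sum>j<b. f i j)"
  proof (rule sum.cong[OF refl])
    fix i
    have "sum (\<lambda>k. f (k div b) (k mod b)) {0 + i * b..<b + i * b}
        = (\<Sum>j = 0..<b. f ((j + i * b) div b) ((j + i * b) mod b))"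
      by (rule sum.shift_bounds_nat_ivl)
    also have "\<dots> = (\<Sum>j<b. f i j)"
      using False by (auto simp: lessThan_atLeast0 intro!: sum.cong)
    finally show "sum (\<lambda>k. f (k div b) (k mod b)) {i * b..<i * b + b} = (\<Sum>j<b. f i j)"
      by (simp add: add.commute)
  qed
  finally show ?thesis .
qed simp

lemma div_mod_less_mult:
  assumes "k < a * (b::nat)"
  shows "k div b < a" "k mod b < b"
proof -
  have "0 < b" using assms by (cases b) auto
  then show "k div b < a" "k mod b < b"
    using assms by (auto simp: less_mult_imp_div_less)
qed

lemma kron_carrier [simp, intro]:
  "A \<in> carrier_mat n m \<Longrightarrow> B \<in> carrier_mat n' m' \<Longrightarrow> kron A B \<in> carrier_mat (n * n') (m * m')"
  by (auto simp: kron_def)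

lemma dim_kron [simp]:
  "dim_row (kron A B) = dim_row A * dim_row B" "dim_col (kron A B) = dim_col A * dim_col B"
  by (simp_all add: kron_def)

lemma kron_index:
  "i < dim_row A * dim_row B \<Longrightarrow> j < dim_col A * dim_col B \<Longrightarrow>
   kron A B $$ (i, j) = A $$ (i div dim_row B, j div dim_col B) * B $$ (i mod dim_row B, j mod dim_col B)"
  by (simp add: kron_def)

text \<open>The inner summation index runs over \<open>m * m'\<close> basis positions. Splitting it
  by \<open>div\<close> and \<open>mod\<close> turns the sum into a double sum, which factors into
  the two matrix products.\<close>

lemma kron_mult:
  assumes "A \<in> carrier_mat n m" "C \<in> carrier_mat m l" "B \<in> carrier_mat n' m'" "D \<in> carrier_mat m' l'"
  shows "kron A B * kron C D = kron (A * C) (B * D)"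
proof (rule eq_matI)
  have dims: "dim_row A = n" "dim_col A = m" "dim_row C = m" "dim_col C = l"
    "dim_row B = n'" "dim_col B = m'" "dim_row D = m'" "dim_col D = l'"
    using assms by auto
  fix i j assume "i < dim_row (kron (A * C) (B * D))" "j < dim_col (kron (A * C) (B * D))"
  then have ij: "i < n * n'" "j < l * l'" by (simp_all add: dims)
  note ij' = div_mod_less_mult[OF ij(1)] div_mod_less_mult[OF ij(2)]
  have "(kron A B * kron C D) $$ (i, j)
      = (\<Sum>k<m * m'. (A $$ (i div n', k div m') * B $$ (i mod n', k mod m')) *
          (C $$ (k div m', j div l') * D $$ (k mod m', j mod l')))"
    using ij by (simp add: dims scalar_prod_def lessThan_atLeast0 kron_index)
  also have "\<dots> = (\<Sum>p<m. \<Sum>q<m'. (A $$ (i div n', p) * B $$ (i mod n', q)) *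
          (C $$ (p, j div l') * D $$ (q, j mod l')))"
    by (rule sum_div_mod)
  also have "\<dots> = (\<Sum>p<m. A $$ (i div n', p) * C $$ (p, j div l')) *
      (\<Sum>q<m'. B $$ (i mod n', q) * D $$ (q, j mod l'))"
    by (simp add: sum_product ac_simps)
  also have "\<dots> = kron (A * C) (B * D) $$ (i, j)"
    using ij ij' by (simp add: dims kron_index scalar_prod_def lessThan_atLeast0)
  finally show "(kron A B * kron C D) $$ (i, j) = kron (A * C) (B * D) $$ (i, j)" .
qed (use assms in auto)

lemma adj_kron: "adj (kron A B) = kron (adj A) (adj B)"
proof (rule eq_matI)
  fix i j assume "i < dim_row (kron (adj A) (adj B))" "j < dim_col (kron (adj A) (adj B))"
  then have ij: "i < dim_col A * dim_col B" "j < dim_row A * dim_row B" by auto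
  show "adj (kron A B) $$ (i, j) = kron (adj A) (adj B) $$ (i, j)"
    using ij div_mod_less_mult[OF ij(1)] div_mod_less_mult[OF ij(2)] by (simp add: kron_index)
qed auto

lemma kron_one: "kron (1\<^sub>m n) (1\<^sub>m m) = 1\<^sub>m (n * m)"
proof (rule eq_matI)
  fix i j assume "i < dim_row (1\<^sub>m (n * m) :: complex mat)" "j < dim_col (1\<^sub>m (n * m) :: complex mat)"
  then have ij: "i < n * m" "j < n * m" by auto
  have "i = j \<longleftrightarrow> i div m = j div m \<and> i mod m = j mod m"
    by (metis div_mult_mod_eq)
  then show "kron (1\<^sub>m n) (1\<^sub>m m) $$ (i, j) = 1\<^sub>m (n * m) $$ (i, j)"
    using ij div_mod_less_mult[OF ij(1)] div_mod_less_mult[OF ij(2)] by (auto simp: kron_index)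
qed auto

lemma kron_mat_sum_left:
  assumes "\<And>k. k \<in> I \<Longrightarrow> F k \<in> carrier_mat n n" "B \<in> carrier_mat m m"
  shows "kron (mat_sum n F I) B = mat_sum (n * m) (\<lambda>k. kron (F k) B) I"
proof (rule eq_matI)
  fix i j assume "i < dim_row (mat_sum (n * m) (\<lambda>k. kron (F k) B) I)"
    "j < dim_col (mat_sum (n * m) (\<lambda>k. kron (F k) B) I)"
  then have ij: "i < n * m" "j < n * m" by auto
  have F: "dim_row (F k) = n" "dim_col (F k) = n" if "k \<in> I" for k
    using assms(1)[OF that] by auto
  have B: "dim_row B = m" "dim_col B = m"
    using assms by auto
  show "kron (mat_sum n F I) B $$ (i, j) = mat_sum (n * m) (\<lambda>k. kron (F k) B) I $$ (i, j)"
    using ij div_mod_less_mult[OF ij(1)] div_mod_less_mult[OF ij(2)]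
    by (simp add: kron_index F B sum_distrib_right cong: sum.cong)
qed (use assms in auto)

lemma kron_mat_sum_right:
  assumes "\<And>k. k \<in> I \<Longrightarrow> F k \<in> carrier_mat m m" "A \<in> carrier_mat n n"
  shows "kron A (mat_sum m F I) = mat_sum (n * m) (\<lambda>k. kron A (F k)) I"
proof (rule eq_matI)
  fix i j assume "i < dim_row (mat_sum (n * m) (\<lambda>k. kron A (F k)) I)"
    "j < dim_col (mat_sum (n * m) (\<lambda>k. kron A (F k)) I)"
  then have ij: "i < n * m" "j < n * m" by auto
  have F: "dim_row (F k) = m" "dim_col (F k) = m" if "k \<in> I" for k
    using assms(1)[OF that] by auto
  have A: "dim_row A = n" "dim_col A = n"
    using assms by auto
  show "kron A (mat_sum m F I) $$ (i, j) = mat_sum (n * m) (\<lambda>k. kron A (F k)) I $$ (i, j)"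
    using ij div_mod_less_mult[OF ij(1)] div_mod_less_mult[OF ij(2)]
    by (simp add: kron_index F A sum_distrib_left cong: sum.cong)
qed (use assms in auto)

section \<open>Traces and expectation values\<close>

lemma mat_trace_mult:
  "A \<in> carrier_mat n m \<Longrightarrow> B \<in> carrier_mat m n \<Longrightarrow>
   mat_trace (A * B) = (\<Sum>i<n. \<Sum>j<m. A $$ (i, j) * B $$ (j, i))"
  by (simp add: mat_trace_def scalar_prod_def lessThan_atLeast0)

lemma mat_trace_comm:
  assumes "A \<in> carrier_mat n m" "B \<in> carrier_mat m n"
  shows "mat_trace (A * B) = mat_trace (B * A)"
  unfolding mat_trace_mult[OF assms] mat_trace_mult[OF assms(2,1)]
  by (subst sum.swap) (simp add: mult.commute)

lemma mat_trace_add: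
  "A \<in> carrier_mat n n \<Longrightarrow> B \<in> carrier_mat n n \<Longrightarrow> mat_trace (A + B) = mat_trace A + mat_trace B"
  by (simp add: mat_trace_def sum.distrib)

lemma mat_trace_smult: "A \<in> carrier_mat n n \<Longrightarrow> mat_trace (c \<cdot>\<^sub>m A) = c * mat_trace A"
  by (simp add: mat_trace_def sum_distrib_left)

lemma mat_trace_mat_sum_mult:
  assumes "\<And>k. k \<in> I \<Longrightarrow> F k \<in> carrier_mat n n" "B \<in> carrier_mat n n"
  shows "mat_trace (mat_sum n F I * B) = (\<Sum>k\<in>I. mat_trace (F k * B))"
proof -
  have "mat_trace (mat_sum n F I * B) = (\<Sum>i<n. \<Sum>j<n. \<Sum>k\<in>I. F k $$ (i, j) * B $$ (j, i))"
    by (simp add: mat_trace_mult[OF mat_sum_carrier assms(2)] sum_distrib_right)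
  also have "\<dots> = (\<Sum>i<n. \<Sum>k\<in>I. \<Sum>j<n. F k $$ (i, j) * B $$ (j, i))"
    by (rule sum.cong[OF refl], rule sum.swap)
  also have "\<dots> = (\<Sum>k\<in>I. \<Sum>i<n. \<Sum>j<n. F k $$ (i, j) * B $$ (j, i))"
    by (rule sum.swap)
  also have "\<dots> = (\<Sum>k\<in>I. mat_trace (F k * B))"
    by (simp add: mat_trace_mult[OF assms(1) assms(2)])
  finally show ?thesis .
qed

lemma psd_trace_nonneg:
  assumes "psd n A"
  shows "0 \<le> mat_trace A"
proof -
  have "0 \<le> A $$ (i, i)" if "i < n" for i
    using psd_qform[OF assms] qform_entry[OF that that] by metis
  then show ?thesis
    using psd_carrier[OF assms] by (auto simp: mat_trace_def intro!: sum_nonneg)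
qed

text \<open>Factoring both effects gives \<open>kron A B = adj X * X\<close> with
  \<open>X = kron V U\<close>, and cyclicity rewrites the trace as that of the positive operator
  \<open>X * \<rho> * adj X\<close>.\<close>

lemma trace_kron_nonneg:
  assumes "psd n A" "psd m B" "psd (n * m) \<rho>"
  shows "0 \<le> mat_trace (kron A B * \<rho>)"
proof -
  obtain r V where V: "V \<in> carrier_mat r n" "A = adj V * V"
    using psd_factor[OF assms(1)] by blast
  obtain s U where U: "U \<in> carrier_mat s m" "B = adj U * U"
    using psd_factor[OF assms(2)] by blast
  define X where "X = kron V U"
  have X: "X \<in> carrier_mat (r * s) (n * m)" using V U by (simp add: X_def)
  have \<rho>: "\<rho> \<in> carrier_mat (n * m) (n * m)" using assms(3) by (rule psd_carrier)
  have "kron A B = adj X * X"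
    using V U by (simp add: X_def adj_kron kron_mult[of _ n r _ n _ m s _ m])
  then have "mat_trace (kron A B * \<rho>) = mat_trace (adj X * (X * \<rho>))"
    using X \<rho> by (simp add: assoc_mult_mat[of _ "n * m" "r * s" _ "n * m" _ "n * m"])
  also have "\<dots> = mat_trace (X * \<rho> * adj X)"
    using X \<rho> by (intro mat_trace_comm[of _ "n * m" "r * s"]) auto
  also have "0 \<le> \<dots>"
    using psd_congruence[OF assms(3), of "adj X" "r * s"] X by (auto intro: psd_trace_nonneg)
  finally show ?thesis .
qed

text \<open>Cyclicity moves a local operation from the state to the effects. \<open>V\<close> and
  \<open>U\<close> may be rectangular: the lemma serves both for the compression to the support of a
  total effect and for embedding a state into a direct sum.\<close>

lemma trace_kron_congruence:
  assumes "V \<in> carrier_mat r n" "U \<in> carrier_mat s m" "\<rho> \<in> carrier_mat (n * m) (n * m)"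
    "E \<in> carrier_mat r r" "F \<in> carrier_mat s s"
  shows "mat_trace (kron E F * (kron V U * \<rho> * adj (kron V U)))
    = mat_trace (kron (adj V * E * V) (adj U * F * U) * \<rho>)"
proof -
  define X where "X = kron V U"
  define Y where "Y = kron E F"
  have c: "X \<in> carrier_mat (r * s) (n * m)" "Y \<in> carrier_mat (r * s) (r * s)"
    using assms by (auto simp: X_def Y_def)
  have "Y * (X * \<rho> * adj X) = (Y * X * \<rho>) * adj X"
    using c assms(3) by (simp add: assoc_mult_mat[of _ "r * s" "n * m" _ "n * m" _ "r * s"]
        assoc_mult_mat[of _ "r * s" "r * s" _ "n * m" _ "r * s"])
  then have "mat_trace (Y * (X * \<rho> * adj X)) = mat_trace (adj X * (Y * X * \<rho>))"
    using c assms(3) mat_trace_comm[of "Y * X * \<rho>" "r * s" "n * m" "adj X"] by auto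
  also have "adj X * (Y * X * \<rho>) = adj X * Y * X * \<rho>"
    using c assms(3) by (simp add: assoc_mult_mat[of _ "r * s" "r * s" _ "n * m" _ "n * m"]
        assoc_mult_mat[of _ "n * m" "r * s" _ "n * m" _ "n * m"]
        assoc_mult_mat[of _ "n * m" "r * s" _ "r * s" _ "n * m"])
  also have "adj X * Y * X = kron (adj V * E * V) (adj U * F * U)"
    using assms mult_carrier_mat[of "adj V" n r E r] mult_carrier_mat[of "adj U" m s F s]
    by (simp add: X_def Y_def adj_kron kron_mult[of _ n r _ r _ m s _ s]
        kron_mult[of _ n r _ n _ m s _ m])
  finally show ?thesis by (simp add: X_def Y_def)
qed


lemma trace_kron_mat_sum_left:
  assumes "\<And>k. k \<in> I \<Longrightarrow> F k \<in> carrier_mat n n" "B \<in> carrier_mat m m" "\<rho> \<in> carrier_mat (n * m) (n * m)"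
  shows "mat_trace (kron (mat_sum n F I) B * \<rho>) = (\<Sum>k\<in>I. mat_trace (kron (F k) B * \<rho>))"
  using assms by (simp add: kron_mat_sum_left mat_trace_mat_sum_mult)

lemma trace_kron_mat_sum_right:
  assumes "\<And>k. k \<in> I \<Longrightarrow> F k \<in> carrier_mat m m" "A \<in> carrier_mat n n" "\<rho> \<in> carrier_mat (n * m) (n * m)"
  shows "mat_trace (kron A (mat_sum m F I) * \<rho>) = (\<Sum>k\<in>I. mat_trace (kron A (F k) * \<rho>))"
  using assms by (simp add: kron_mat_sum_right mat_trace_mat_sum_mult)

lemma trace_kron_mat_sum:
  assumes "\<And>k. k \<in> I \<Longrightarrow> F k \<in> carrier_mat n n" "\<And>l. l \<in> J \<Longrightarrow> H l \<in> carrier_mat m m"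
    "\<rho> \<in> carrier_mat (n * m) (n * m)"
  shows "mat_trace (kron (mat_sum n F I) (mat_sum m H J) * \<rho>)
    = (\<Sum>k\<in>I. \<Sum>l\<in>J. mat_trace (kron (F k) (H l) * \<rho>))"
  using assms by (simp add: trace_kron_mat_sum_left[where m = m] trace_kron_mat_sum_right[where n = n])
    (rule sum.swap)

section \<open>From compatibility to perfect guessing\<close>

lemma povm_psd: "povm n d M \<Longrightarrow> a < d \<Longrightarrow> psd n (M a)"
  by (simp add: povm_def)

lemma povm_carrier: "povm n d M \<Longrightarrow> a < d \<Longrightarrow> M a \<in> carrier_mat n n"
  by (simp add: povm_psd psd_carrier)

lemma povm_sum: "povm n d M \<Longrightarrow> mat_sum n M {..<d} = 1\<^sub>m n"
  by (simp add: povm_def)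

lemma mat_sum_zero_except:
  assumes "finite I" "k \<in> I" "A \<in> carrier_mat n n"
  shows "mat_sum n (\<lambda>l. if l = k then A else 0\<^sub>m n n) I = A"
proof (rule eq_matI)
  fix i j assume "i < dim_row A" "j < dim_col A"
  then have "i < n" "j < n" using assms by auto
  then have "mat_sum n (\<lambda>l. if l = k then A else 0\<^sub>m n n) I $$ (i, j)
      = (\<Sum>l\<in>I. if l = k then A $$ (i, j) else 0)"
    unfolding mat_sum_def by (auto intro!: sum.cong)
  then show "mat_sum n (\<lambda>l. if l = k then A else 0\<^sub>m n n) I $$ (i, j) = A $$ (i, j)"
    using assms by simp
qed (use assms in auto)

text \<open>The \<open>\<lambda>\<close>-th parent effect contributes to \<open>(e, a)\<close> with weight \<open>p(e|c,\<lambda>) p(a|x,\<lambda>)\<close>.\<close>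

lemma compatible_joint_povm:
  assumes "compatible n d M {c, x}"
  obtains G where "\<And>e a. e < d \<Longrightarrow> a < d \<Longrightarrow> psd n (G e a)"
    "\<And>e. e < d \<Longrightarrow> mat_sum n (G e) {..<d} = M c e"
    "\<And>a. a < d \<Longrightarrow> mat_sum n (\<lambda>e. G e a) {..<d} = M x a"
proof -
  obtain k \<Gamma> and r :: "nat \<Rightarrow> nat \<Rightarrow> nat \<Rightarrow> real" where \<Gamma>: "povm n k \<Gamma>"
    and r_all: "\<forall>z\<in>{c, x}. \<forall>l<k. (\<forall>a<d. 0 \<le> r a z l) \<and> (\<Sum>a<d. r a z l) = 1"
    and M_all: "\<forall>z\<in>{c, x}. \<forall>a<d.
        M z a = mat_sum n (\<lambda>l. complex_of_real (r a z l) \<cdot>\<^sub>m \<Gamma> l) {..<k}"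
    using assms unfolding compatible_def by (elim exE conjE)
  have r: "0 \<le> r a z l" "(\<Sum>a<d. r a z l) = 1" if "z \<in> {c, x}" "l < k" "a < d" for z l a
    using r_all that by blast+
  have M: "M z a = mat_sum n (\<lambda>l. complex_of_real (r a z l) \<cdot>\<^sub>m \<Gamma> l) {..<k}"
    if "z \<in> {c, x}" "a < d" for z a
    using M_all that by blast
  define G where "G e a = mat_sum n (\<lambda>l. complex_of_real (r e c l * r a x l) \<cdot>\<^sub>m \<Gamma> l) {..<k}" for e a
  have \<Gamma>_dim: "dim_row (\<Gamma> l) = n" "dim_col (\<Gamma> l) = n" if "l < k" for l
    using povm_carrier[OF \<Gamma> that] by auto
  have G_entry: "G e a $$ (i, j) = (\<Sum>l<k. complex_of_real (r e c l) * complex_of_real (r a x l) * \<Gamma> l $$ (i, j))"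
    if "i < n" "j < n" for e a i j
    unfolding G_def using that by (auto simp: \<Gamma>_dim intro!: sum.cong)
  have M_entry: "M z a $$ (i, j) = (\<Sum>l<k. complex_of_real (r a z l) * \<Gamma> l $$ (i, j))"
    if "z \<in> {c, x}" "a < d" "i < n" "j < n" for z a i j
    unfolding M[OF that(1,2)] using that by (auto simp: \<Gamma>_dim intro!: sum.cong)
  have r1: "(\<Sum>a<d. complex_of_real (r a z l)) = 1" if "z \<in> {c, x}" "l < k" for z l
    using r_all that by (metis of_real_1 of_real_sum)
  have Mc: "M z a \<in> carrier_mat n n" if "z \<in> {c, x}" "a < d" for z a
    using M[OF that] by simp
  have "psd n (G e a)" if "e < d" "a < d" for e a
    unfolding G_def using that r \<Gamma> by (intro psd_mat_sum psd_smult povm_psd[OF \<Gamma>]) auto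
  moreover have "mat_sum n (G e) {..<d} = M c e" if "e < d" for e
  proof (rule eq_matI)
    fix i j assume "i < dim_row (M c e)" "j < dim_col (M c e)"
    then have ij: "i < n" "j < n" using Mc[of c e] that by auto
    then have "mat_sum n (G e) {..<d} $$ (i, j)
        = (\<Sum>l<k. \<Sum>a<d. complex_of_real (r e c l) * complex_of_real (r a x l) * \<Gamma> l $$ (i, j))"
      by (simp add: G_entry) (rule sum.swap)
    also have "\<dots> = (\<Sum>l<k. complex_of_real (r e c l) * \<Gamma> l $$ (i, j) * (\<Sum>a<d. complex_of_real (r a x l)))"
      by (simp add: sum_distrib_left ac_simps)
    also have "\<dots> = M c e $$ (i, j)"
      using ij that by (simp add: r1 M_entry)
    finally show "mat_sum n (G e) {..<d} $$ (i, j) = M c e $$ (i, j)" .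
  qed (use Mc[of c e] that in auto)
  moreover have "mat_sum n (\<lambda>e. G e a) {..<d} = M x a" if "a < d" for a
  proof (rule eq_matI)
    fix i j assume "i < dim_row (M x a)" "j < dim_col (M x a)"
    then have ij: "i < n" "j < n" using Mc[of x a] that by auto
    then have "mat_sum n (\<lambda>e. G e a) {..<d} $$ (i, j)
        = (\<Sum>l<k. \<Sum>e<d. complex_of_real (r e c l) * complex_of_real (r a x l) * \<Gamma> l $$ (i, j))"
      by (simp add: G_entry) (rule sum.swap)
    also have "\<dots> = (\<Sum>l<k. complex_of_real (r a x l) * \<Gamma> l $$ (i, j) * (\<Sum>e<d. complex_of_real (r e c l)))"
      by (simp add: sum_distrib_left ac_simps)
    also have "\<dots> = M x a $$ (i, j)"
      using ij that by (simp add: r1 M_entry)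
    finally show "mat_sum n (\<lambda>e. G e a) {..<d} $$ (i, j) = M x a $$ (i, j)" .
  qed (use Mc[of x a] that in auto)
  ultimately show ?thesis using that by blast
qed

text \<open>The star has no edge from the centre to itself. Measuring the centre and copying its
  outcome gives a diagonal joint POVM there, so all settings can be treated alike; diagonality is
  also what makes the guess correct at the guessed setting.\<close>

lemma star_joint_povms:
  assumes star: "star_graph m c \<subseteq> compatibility_structure n m d M"
    and povm: "\<And>x. x \<in> {1..m} \<Longrightarrow> povm n d (M x)"
  obtains G where
    "\<And>x e a. x \<in> {1..m} \<Longrightarrow> e < d \<Longrightarrow> a < d \<Longrightarrow> psd n (G x e a)"
    "\<And>x e. x \<in> {1..m} \<Longrightarrow> e < d \<Longrightarrow> mat_sum n (G x e) {..<d} = M c e"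
    "\<And>x a. x \<in> {1..m} \<Longrightarrow> a < d \<Longrightarrow> mat_sum n (\<lambda>e. G x e a) {..<d} = M x a"
    "\<And>e a. G c e a = (if a = e then M c e else 0\<^sub>m n n)"
proof -
  define joint where "joint x G \<longleftrightarrow> (\<forall>e<d. \<forall>a<d. psd n (G e a)) \<and>
      (\<forall>e<d. mat_sum n (G e) {..<d} = M c e) \<and> (\<forall>a<d. mat_sum n (\<lambda>e. G e a) {..<d} = M x a)"
    for x and G :: "nat \<Rightarrow> nat \<Rightarrow> complex mat"
  have "\<exists>G. joint x G" if "x \<in> {1..m}" "x \<noteq> c" for x
  proof -
    have "compatible n d M {c, x}"
      using star that by (auto simp: star_graph_def compatibility_structure_def)
    from compatible_joint_povm[OF this] show ?thesis unfolding joint_def by metis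
  qed
  then obtain G where joint_G: "\<And>x. x \<in> {1..m} \<Longrightarrow> x \<noteq> c \<Longrightarrow> joint x (G x)"
    by metis
  note G = joint_G[unfolded joint_def, THEN conjunct1, rule_format]
    joint_G[unfolded joint_def, THEN conjunct2, THEN conjunct1, rule_format]
    joint_G[unfolded joint_def, THEN conjunct2, THEN conjunct2, rule_format]
  define G' where "G' x e a = (if x = c then if a = e then M c e else 0\<^sub>m n n else G x e a)" for x e a
  have "psd n (G' x e a)" if "x \<in> {1..m}" "e < d" "a < d" for x e a
    using that G(1)[of x e a] povm_psd[OF povm[of c], of e] by (auto simp: G'_def psd_zero)
  moreover have "mat_sum n (G' x e) {..<d} = M c e" if "x \<in> {1..m}" "e < d" for x e
  proof (cases "x = c")
    case True
    have "mat_sum n (G' x e) {..<d} = mat_sum n (\<lambda>a. if a = e then M c e else 0\<^sub>m n n) {..<d}"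
      by (rule mat_sum_cong) (simp add: G'_def True)
    then show ?thesis
      using that True mat_sum_zero_except[of "{..<d}" e "M c e" n] povm_carrier[OF povm[of c]] by auto
  next
    case False
    then have "G' x e = G x e" by (auto simp: G'_def)
    then show ?thesis using that False G by simp
  qed
  moreover have "mat_sum n (\<lambda>e. G' x e a) {..<d} = M x a" if "x \<in> {1..m}" "a < d" for x a
  proof (cases "x = c")
    case True
    have "mat_sum n (\<lambda>e. G' x e a) {..<d} = mat_sum n (\<lambda>e. if e = a then M c a else 0\<^sub>m n n) {..<d}"
      by (rule mat_sum_cong) (auto simp: G'_def True)
    then show ?thesis
      using that True mat_sum_zero_except[of "{..<d}" a "M c a" n] povm_carrier[OF povm[of c]] by auto
  qed (use that G in \<open>simp add: G'_def\<close>)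
  moreover have "G' c e a = (if a = e then M c e else 0\<^sub>m n n)" for e a
    by (simp add: G'_def)
  ultimately show ?thesis using that[of G'] by blast
qed

text \<open>This replaces the usual \<open>K\<^bsup>-1/2\<^esup> F a K\<^bsup>-1/2\<^esup>\<close>. As \<open>V\<close> has full row rank, no completion outside
  the support of \<open>K\<close> is needed.\<close>

lemma subnormalized_povm:
  assumes K: "psd n K"
  obtains r V where "V \<in> carrier_mat r n" "adj V * V = K"
    "\<And>F d. (\<And>a. a < d \<Longrightarrow> psd n (F a)) \<Longrightarrow> mat_sum n F {..<d} = K \<Longrightarrow>
       \<exists>E. povm r d E \<and> (\<forall>a<d. adj V * E a * V = F a)"
proof -
  obtain r W where W: "W \<in> carrier_mat n r" "adj W * K * W = 1\<^sub>m r"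
    and absorb: "\<And>G. psd n G \<Longrightarrow> (\<And>f. qform n K f f = 0 \<Longrightarrow> qform n G f f = 0) \<Longrightarrow>
      G * (W * (adj W * K)) = G"
    using psd_compression[OF K] by metis
  have Kc: "K \<in> carrier_mat n n" using K by (rule psd_carrier)
  define V where "V = adj W * K"
  have V: "V \<in> carrier_mat r n" using W Kc unfolding V_def by (intro mult_carrier_mat) auto
  have adjV: "adj V = K * W"
    using W Kc psd_hermitian[OF K] by (simp add: V_def adj_mult[of _ r n _ n])
  have adjWV: "adj (W * V) = adj V * adj W"
    using W V by (simp add: adj_mult[of _ n r _ n])
  have "adj V * V = K"
    using absorb[OF K] W V Kc by (simp add: adjV flip: V_def)
  moreover have "\<exists>E. povm r d E \<and> (\<forall>a<d. adj V * E a * V = F a)"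
    if F: "\<And>a. a < d \<Longrightarrow> psd n (F a)" and FK: "mat_sum n F {..<d} = K" for F d
  proof -
    define E where "E a = adj W * F a * W" for a
    have Fc: "F a \<in> carrier_mat n n" if "a < d" for a
      using F[OF that] by (rule psd_carrier)
    have "mat_sum r E {..<d} = 1\<^sub>m r"
      unfolding E_def using mat_sum_mult[of "adj W" r n W "{..<d}" F] W Fc by (simp add: FK)
    moreover have "psd r (E a)" if "a < d" for a
      unfolding E_def using F[OF that] W(1) by (rule psd_congruence)
    moreover have "adj V * E a * V = F a" if a: "a < d" for a
    proof -
      \<comment> \<open>\<open>K\<close> is the sum of the positive \<open>F a\<close>, so a null
        vector of \<open>K\<close> is null for each of them.\<close>
      have null: "qform n (F a) f f = 0" if "qform n K f f = 0" for f
      proof -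
        have "(\<Sum>a<d. qform n (F a) f f) = 0"
          using that by (simp add: qform_mat_sum flip: FK)
        then show ?thesis
          using sum_nonneg_eq_0_iff[of "{..<d}" "\<lambda>a. qform n (F a) f f"] psd_qform[OF F] a by auto
      qed
      have FWV: "F a * (W * V) = F a"
        unfolding V_def by (rule absorb[OF F[OF a] null])
      \<comment> \<open>Absorption on the right becomes absorption on the left by taking adjoints,
        as \<open>F a\<close> is Hermitian.\<close>
      have "adj (F a * (W * V)) = adj V * adj W * F a"
        using W V Fc[OF a] by (simp add: adj_mult[of _ n n _ n] adjWV psd_hermitian[OF F[OF a]])
      then have WVF: "adj V * adj W * F a = F a"
        by (simp add: FWV psd_hermitian[OF F[OF a]])
      have "adj V * E a * V = adj V * (adj W * F a * W) * V"
        by (simp add: E_def)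
      also have "adj V * (adj W * F a * W) = adj V * adj W * F a * W"
        using W V Fc[OF a] mult_carrier_mat[of "adj W" r n "F a" n]
        by (simp add: assoc_mult_mat[of "adj V" n r _ n _ r, symmetric]
            assoc_mult_mat[of "adj V" n r _ n _ n, symmetric])
      also have "\<dots> * V = adj V * adj W * F a * (W * V)"
        using W V Fc[OF a] mult_carrier_mat[of "adj V" n r "adj W" n]
        by (intro assoc_mult_mat[of _ n n _ r _ n] mult_carrier_mat) auto
      finally show ?thesis by (simp add: WVF FWV)
    qed
    ultimately show ?thesis
      by (intro exI[of _ E]) (simp add: povm_def)
  qed
  ultimately show ?thesis using that V by blast
qed

text \<open>The number \<open>c\<close> is the probability of the pair of guesses with total effects
  \<open>K\<close> and \<open>L\<close>. If it is positive, the conditional state is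
  \<open>kron V U * \<rho> * adj (kron V U) / c\<close>, measured with the normalized effects. These
  depend on the setting but the state does not, because all settings share the same totals.\<close>

lemma subnormalized_behavior:
  fixes q :: behavior
  assumes \<rho>: "density_operator (n * n') \<rho>" and K: "psd n K" and L: "psd n' L"
    and F: "\<And>x a. x \<in> {1..m} \<Longrightarrow> a < d \<Longrightarrow> psd n (F x a)"
      "\<And>x. x \<in> {1..m} \<Longrightarrow> mat_sum n (F x) {..<d} = K"
    and H: "\<And>y b. y \<in> {1..m} \<Longrightarrow> b < d \<Longrightarrow> psd n' (H y b)"
      "\<And>y. y \<in> {1..m} \<Longrightarrow> mat_sum n' (H y) {..<d} = L"
    and q: "\<And>a b x y. a < d \<Longrightarrow> b < d \<Longrightarrow> x \<in> {1..m} \<Longrightarrow> y \<in> {1..m} \<Longrightarrow>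
      complex_of_real (q a b x y) = mat_trace (kron (F x a) (H y b) * \<rho>)"
    and nonempty: "p\<^sub>0 \<in> quantum_set m d"
  shows "q \<in> unnormalized_quantum_set m d"
proof -
  have \<rho>p: "psd (n * n') \<rho>" and \<rho>c: "\<rho> \<in> carrier_mat (n * n') (n * n')"
    using \<rho> by (auto simp: density_operator_def intro: psd_carrier)
  define c where "c = Re (mat_trace (kron K L * \<rho>))"
  have c: "complex_of_real c = mat_trace (kron K L * \<rho>)" "0 \<le> c"
    using trace_kron_nonneg[OF K L \<rho>p] by (auto simp: c_def less_eq_complex_def complex_eq_iff)
  show ?thesis
  proof (cases "c = 0")
    case True
    have "q a b x y = 0" if "a < d" "b < d" "x \<in> {1..m}" "y \<in> {1..m}" for a b x y
    proof -
      have nonneg: "0 \<le> mat_trace (kron (F x a) (H y b) * \<rho>)" if "a < d" "b < d" for a b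
        using \<open>x \<in> {1..m}\<close> \<open>y \<in> {1..m}\<close> that F H by (intro trace_kron_nonneg[OF _ _ \<rho>p]) auto
      \<comment> \<open>A guess of probability zero: the trace with \<open>kron K L\<close> splits
        into the nonnegative traces of all outcome pairs, so each of them vanishes.\<close>
      have "0 = mat_trace (kron (mat_sum n (F x) {..<d}) (mat_sum n' (H y) {..<d}) * \<rho>)"
        using c True that by (simp add: F H)
      also have "\<dots> = (\<Sum>a<d. \<Sum>b<d. mat_trace (kron (F x a) (H y b) * \<rho>))"
        using that \<rho>c F(1) H(1) by (intro trace_kron_mat_sum) (auto intro!: psd_carrier)
      finally have "(\<Sum>b<d. mat_trace (kron (F x a) (H y b) * \<rho>)) = 0"
        using sum_nonneg_eq_0_iff[of "{..<d}" "\<lambda>a. \<Sum>b<d. mat_trace (kron (F x a) (H y b) * \<rho>)"]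
          nonneg \<open>a < d\<close> by (metis (no_types, lifting) finite_lessThan lessThan_iff sum_nonneg)
      then have "mat_trace (kron (F x a) (H y b) * \<rho>) = 0"
        using sum_nonneg_eq_0_iff[of "{..<d}" "\<lambda>b. mat_trace (kron (F x a) (H y b) * \<rho>)"]
          nonneg that by simp
      then show ?thesis using q[OF that] by simp
    qed
    \<comment> \<open>Weight \<open>0\<close> still has to multiply an actual quantum behavior, for
      which \<open>p\<^sub>0\<close> is supplied.\<close>
    then show ?thesis
      using nonempty by (auto simp: unnormalized_quantum_set_def intro!: exI[of _ 0])
  next
    case False
    then have "0 < c" using c by simp
    obtain r V where V: "V \<in> carrier_mat r n" "adj V * V = K"
      and EV: "\<And>F d. (\<And>a. a < d \<Longrightarrow> psd n (F a)) \<Longrightarrow> mat_sum n F {..<d} = K \<Longrightarrow>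
        \<exists>E. povm r d E \<and> (\<forall>a<d. adj V * E a * V = F a)"
      using subnormalized_povm[OF K] by metis
    obtain s U where U: "U \<in> carrier_mat s n'" "adj U * U = L"
      and EU: "\<And>F d. (\<And>a. a < d \<Longrightarrow> psd n' (F a)) \<Longrightarrow> mat_sum n' F {..<d} = L \<Longrightarrow>
        \<exists>E. povm s d E \<and> (\<forall>a<d. adj U * E a * U = F a)"
      using subnormalized_povm[OF L] by metis
    have "\<exists>E. povm r d E \<and> (\<forall>a<d. adj V * E a * V = F x a)" if "x \<in> {1..m}" for x
      using EV that F by blast
    then obtain M where M: "\<And>x. x \<in> {1..m} \<Longrightarrow> povm r d (M x)"
      "\<And>x a. x \<in> {1..m} \<Longrightarrow> a < d \<Longrightarrow> adj V * M x a * V = F x a"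
      by metis
    have "\<exists>E. povm s d E \<and> (\<forall>b<d. adj U * E b * U = H y b)" if "y \<in> {1..m}" for y
      using EU that H by blast
    then obtain N where N: "\<And>y. y \<in> {1..m} \<Longrightarrow> povm s d (N y)"
      "\<And>y b. y \<in> {1..m} \<Longrightarrow> b < d \<Longrightarrow> adj U * N y b * U = H y b"
      by metis
    define \<sigma> where "\<sigma> = kron V U * \<rho> * adj (kron V U)"
    have X: "kron V U \<in> carrier_mat (r * s) (n * n')" using V U by simp
    have \<sigma>p: "psd (r * s) \<sigma>"
      unfolding \<sigma>_def using psd_congruence[OF \<rho>p, of "adj (kron V U)" "r * s"] X by simp
    have \<sigma>c: "\<sigma> \<in> carrier_mat (r * s) (r * s)" using \<sigma>p by (rule psd_carrier)
    have tr: "mat_trace (kron A B * (complex_of_real (1 / c) \<cdot>\<^sub>m \<sigma>))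
        = mat_trace (kron (adj V * A * V) (adj U * B * U) * \<rho>) / of_real c"
      if "A \<in> carrier_mat r r" "B \<in> carrier_mat s s" for A B
      using that \<sigma>c V(1) U(1) \<rho>c
        mat_trace_smult[of "kron A B * \<sigma>" "r * s" "complex_of_real (1 / c)"]
        mult_carrier_mat[of "kron A B" "r * s" "r * s" \<sigma> "r * s"]
      by (simp add: mult_smult_distrib[of _ "r * s" "r * s" _ "r * s"]
          trace_kron_congruence[of V r n U s n' \<rho> A B, folded \<sigma>_def] divide_inverse mult.commute)
    \<comment> \<open>Taking identities as effects turns them into \<open>adj V * V = K\<close> and
      \<open>adj U * U = L\<close>, whose expectation is \<open>c\<close>.\<close>
    have "mat_trace (complex_of_real (1 / c) \<cdot>\<^sub>m \<sigma>) = 1"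
      using tr[of "1\<^sub>m r" "1\<^sub>m s"] \<sigma>c V U False
      by (simp add: kron_one right_mult_one_mat[of _ n r] right_mult_one_mat[of _ n' s] flip: c(1))
    then have "density_operator (r * s) (complex_of_real (1 / c) \<cdot>\<^sub>m \<sigma>)"
      using psd_smult[OF \<sigma>p, of "1 / c"] c(2) by (simp add: density_operator_def)
    moreover have "complex_of_real (q a b x y / c)
        = mat_trace (kron (M x a) (N y b) * (complex_of_real (1 / c) \<cdot>\<^sub>m \<sigma>))"
      if "a < d" "b < d" "x \<in> {1..m}" "y \<in> {1..m}" for a b x y
      using that by (simp add: tr povm_carrier[OF M(1)] povm_carrier[OF N(1)] M(2) N(2) q
          del: of_real_divide) (simp add: q)
    ultimately have "realizes m d r s M N (complex_of_real (1 / c) \<cdot>\<^sub>m \<sigma>) (\<lambda>a b x y. q a b x y / c)"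
      using M(1) N(1) by (simp add: realizes_def)
    then have "(\<lambda>a b x y. q a b x y / c) \<in> quantum_set m d"
      unfolding quantum_set_def by blast
    then show ?thesis
      unfolding unnormalized_quantum_set_def using \<open>0 < c\<close>
      by (intro CollectI exI[of _ c]) (auto intro!: bexI[of _ "\<lambda>a b x y. q a b x y / c"])
  qed
qed

lemma density_operator_kron_one:
  assumes "density_operator (n * m) \<rho>"
  shows "mat_trace (kron (1\<^sub>m n) (1\<^sub>m m) * \<rho>) = 1"
  using assms psd_carrier[of "n * m" \<rho>] by (simp add: density_operator_def kron_one)

lemma R_NL_guess_one:
  assumes "pobs \<in> R_NL m d xs ys" and xs: "xs \<in> {1..m}" and ys: "ys \<in> {1..m}"
  shows "1 \<in> guess_values m d pobs xs ys"
proof -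
  obtain nA nB M N \<rho> where real: "realizes m d nA nB M N \<rho> pobs"
    and starA: "star_graph m xs \<subseteq> compatibility_structure nA m d M"
    and starB: "star_graph m ys \<subseteq> compatibility_structure nB m d N"
    using assms(1) by (auto simp: R_NL_def)
  have M: "\<And>x. x \<in> {1..m} \<Longrightarrow> povm nA d (M x)" and N: "\<And>y. y \<in> {1..m} \<Longrightarrow> povm nB d (N y)"
    and \<rho>: "density_operator (nA * nB) \<rho>"
    and pobs: "\<And>a b x y. a < d \<Longrightarrow> b < d \<Longrightarrow> x \<in> {1..m} \<Longrightarrow> y \<in> {1..m} \<Longrightarrow>
      complex_of_real (pobs a b x y) = mat_trace (kron (M x a) (N y b) * \<rho>)"
    using real by (auto simp: realizes_def)
  have \<rho>p: "psd (nA * nB) \<rho>" and \<rho>c: "\<rho> \<in> carrier_mat (nA * nB) (nA * nB)"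
    using \<rho> by (auto simp: density_operator_def intro: psd_carrier)
  have Q: "pobs \<in> quantum_set m d" unfolding quantum_set_def using real by blast
  obtain G where G: "\<And>x e a. x \<in> {1..m} \<Longrightarrow> e < d \<Longrightarrow> a < d \<Longrightarrow> psd nA (G x e a)"
    "\<And>x e. x \<in> {1..m} \<Longrightarrow> e < d \<Longrightarrow> mat_sum nA (G x e) {..<d} = M xs e"
    "\<And>x a. x \<in> {1..m} \<Longrightarrow> a < d \<Longrightarrow> mat_sum nA (\<lambda>e. G x e a) {..<d} = M x a"
    "\<And>e a. G xs e a = (if a = e then M xs e else 0\<^sub>m nA nA)"
    using star_joint_povms[OF starA M] by blast
  obtain H where H: "\<And>y e b. y \<in> {1..m} \<Longrightarrow> e < d \<Longrightarrow> b < d \<Longrightarrow> psd nB (H y e b)"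
    "\<And>y e. y \<in> {1..m} \<Longrightarrow> e < d \<Longrightarrow> mat_sum nB (H y e) {..<d} = N ys e"
    "\<And>y b. y \<in> {1..m} \<Longrightarrow> b < d \<Longrightarrow> mat_sum nB (\<lambda>e. H y e b) {..<d} = N y b"
    "\<And>e b. H ys e b = (if b = e then N ys e else 0\<^sub>m nB nB)"
    using star_joint_povms[OF starB N] by blast
  \<comment> \<open>The joint probability of guesses \<open>e\<close>, \<open>e'\<close> and
    outcomes \<open>a\<close>, \<open>b\<close> when the joint POVMs of both parties are
    measured.\<close>
  define P :: "nat \<Rightarrow> nat \<Rightarrow> behavior"
    where "P e e' a b x y = Re (mat_trace (kron (G x e a) (H y e' b) * \<rho>))" for e e' a b x y
  have P: "complex_of_real (P e e' a b x y) = mat_trace (kron (G x e a) (H y e' b) * \<rho>)"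
    if "e < d" "e' < d" "a < d" "b < d" "x \<in> {1..m}" "y \<in> {1..m}" for e e' a b x y
    using trace_kron_nonneg[OF G(1) H(1) \<rho>p] that
    by (auto simp: P_def less_eq_complex_def complex_eq_iff)
  have "P e e' \<in> unnormalized_quantum_set m d" if "e < d" "e' < d" for e e'
    by (rule subnormalized_behavior[OF \<rho> povm_psd[OF M[OF xs] that(1)] povm_psd[OF N[OF ys] that(2)]
        G(1)[OF _ that(1)] G(2)[OF _ that(1)] H(1)[OF _ that(2)] H(2)[OF _ that(2)] P[OF that] Q])
  moreover have "(\<Sum>e<d. \<Sum>e'<d. P e e' a b x y) = pobs a b x y"
    if "a < d" "b < d" "x \<in> {1..m}" "y \<in> {1..m}" for a b x y
  proof -
    have "complex_of_real (\<Sum>e<d. \<Sum>e'<d. P e e' a b x y)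
        = (\<Sum>e<d. \<Sum>e'<d. mat_trace (kron (G x e a) (H y e' b) * \<rho>))"
      using that by (simp add: P)
    also have "\<dots> = mat_trace (kron (mat_sum nA (\<lambda>e. G x e a) {..<d}) (mat_sum nB (\<lambda>e. H y e b) {..<d}) * \<rho>)"
      using that \<rho>c G(1) H(1) by (intro trace_kron_mat_sum[symmetric]) (auto intro!: psd_carrier)
    also have "\<dots> = complex_of_real (pobs a b x y)"
      using that by (simp add: G(3) H(3) pobs)
    finally show ?thesis by (simp only: of_real_eq_iff)
  qed
  ultimately have feas: "feasible m d pobs P"
    by (simp add: feasible_def)
  \<comment> \<open>At the guessed settings the joint POVMs are diagonal, so the score sums the
    probabilities of all outcome pairs.\<close>
  have "complex_of_real (\<Sum>e<d. \<Sum>e'<d. P e e' e e' xs ys)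
      = (\<Sum>e<d. \<Sum>e'<d. mat_trace (kron (M xs e) (N ys e') * \<rho>))"
    using xs ys by (simp add: P G(4) H(4))
  also have "\<dots> = mat_trace (kron (mat_sum nA (M xs) {..<d}) (mat_sum nB (N ys) {..<d}) * \<rho>)"
    using \<rho>c povm_carrier[OF M[OF xs]] povm_carrier[OF N[OF ys]]
    by (intro trace_kron_mat_sum[symmetric]) auto
  also have "\<dots> = 1"
    using density_operator_kron_one[OF \<rho>] by (simp add: povm_sum[OF M[OF xs]] povm_sum[OF N[OF ys]])
  finally have "(\<Sum>e<d. \<Sum>e'<d. P e e' e e' xs ys) = 1"
    by (simp only: of_real_eq_1_iff)
  then show ?thesis
    using feas unfolding guess_values_def by (metis (mono_tags, lifting) mem_Collect_eq)
qed


section \<open>Predictable outcomes\<close>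

text \<open>The right side does not mention \<open>y\<close>: this is no-signalling from Bob to
  Alice.\<close>

lemma realizes_marginal_left:
  assumes "realizes m d nA nB M N \<rho> p" "a < d" "x \<in> {1..m}" "y \<in> {1..m}"
  shows "complex_of_real (\<Sum>b<d. p a b x y) = mat_trace (kron (M x a) (1\<^sub>m nB) * \<rho>)"
proof -
  have M: "povm nA d (M x)" and N: "povm nB d (N y)" and \<rho>: "\<rho> \<in> carrier_mat (nA * nB) (nA * nB)"
    using assms by (auto simp: realizes_def density_operator_def intro: psd_carrier)
  have "complex_of_real (\<Sum>b<d. p a b x y) = (\<Sum>b<d. mat_trace (kron (M x a) (N y b) * \<rho>))"
    using assms by (simp add: realizes_def)
  also have "\<dots> = mat_trace (kron (M x a) (mat_sum nB (N y) {..<d}) * \<rho>)"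
    using povm_carrier[OF M] povm_carrier[OF N] \<rho> assms
    by (intro trace_kron_mat_sum_right[symmetric]) auto
  finally show ?thesis by (simp add: povm_sum[OF N])
qed

lemma realizes_marginal_right:
  assumes "realizes m d nA nB M N \<rho> p" "b < d" "x \<in> {1..m}" "y \<in> {1..m}"
  shows "complex_of_real (\<Sum>a<d. p a b x y) = mat_trace (kron (1\<^sub>m nA) (N y b) * \<rho>)"
proof -
  have M: "povm nA d (M x)" and N: "povm nB d (N y)" and \<rho>: "\<rho> \<in> carrier_mat (nA * nB) (nA * nB)"
    using assms by (auto simp: realizes_def density_operator_def intro: psd_carrier)
  have "complex_of_real (\<Sum>a<d. p a b x y) = (\<Sum>a<d. mat_trace (kron (M x a) (N y b) * \<rho>))"
    using assms by (simp add: realizes_def)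
  also have "\<dots> = mat_trace (kron (mat_sum nA (M x) {..<d}) (N y b) * \<rho>)"
    using povm_carrier[OF M] povm_carrier[OF N] \<rho> assms
    by (intro trace_kron_mat_sum_left[symmetric]) auto
  finally show ?thesis by (simp add: povm_sum[OF M])
qed

lemma realizes_nonneg:
  assumes "realizes m d nA nB M N \<rho> p" "a < d" "b < d" "x \<in> {1..m}" "y \<in> {1..m}"
  shows "0 \<le> p a b x y"
proof -
  have "0 \<le> mat_trace (kron (M x a) (N y b) * \<rho>)"
    using assms by (intro trace_kron_nonneg) (auto simp: realizes_def density_operator_def intro: povm_psd)
  also have "\<dots> = complex_of_real (p a b x y)"
    using assms by (simp add: realizes_def)
  finally show ?thesis by (simp add: less_eq_complex_def)
qed

lemma realizes_total:
  assumes real: "realizes m d nA nB M N \<rho> p" and "x \<in> {1..m}" "y \<in> {1..m}"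
  shows "(\<Sum>a<d. \<Sum>b<d. p a b x y) = 1"
proof -
  have M: "povm nA d (M x)" and \<rho>: "density_operator (nA * nB) \<rho>"
    using assms by (auto simp: realizes_def)
  have "complex_of_real (\<Sum>a<d. \<Sum>b<d. p a b x y)
      = (\<Sum>a<d. mat_trace (kron (M x a) (1\<^sub>m nB) * \<rho>))"
    using realizes_marginal_left[OF real _ assms(2,3)] by simp
  also have "\<dots> = mat_trace (kron (mat_sum nA (M x) {..<d}) (1\<^sub>m nB) * \<rho>)"
    using povm_carrier[OF M] \<rho>
    by (intro trace_kron_mat_sum_left[symmetric]) (auto simp: density_operator_def intro: psd_carrier)
  finally show ?thesis
    using density_operator_kron_one[OF \<rho>] by (simp add: povm_sum[OF M] del: of_real_sum)
qed

definition deterministic_povm :: "nat \<Rightarrow> nat \<Rightarrow> nat \<Rightarrow> complex mat" where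
  "deterministic_povm n e a = (if a = e then 1\<^sub>m n else 0\<^sub>m n n)"

lemma povm_deterministic: "e < d \<Longrightarrow> povm n d (deterministic_povm n e)"
  using mat_sum_zero_except[of "{..<d}" e "1\<^sub>m n" n]
  by (auto simp: povm_def deterministic_povm_def[abs_def] psd_one psd_zero)

text \<open>The POVM \<open>M x\<close> is itself a parent: setting \<open>x\<close> reports its
  outcome and setting \<open>c\<close> answers \<open>e\<close> regardless of it.\<close>

lemma compatible_deterministic:
  assumes c: "M c = deterministic_povm n e" and "e < d" and x: "povm n d (M x)" "x \<noteq> c"
  shows "compatible n d M {c, x}"
proof -
  define r :: "nat \<Rightarrow> nat \<Rightarrow> nat \<Rightarrow> real"
    where "r a z l = (if z = c then of_bool (a = e) else of_bool (a = l))" for a z l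
  have dim: "dim_row (M x l) = n" "dim_col (M x l) = n" if "l < d" for l
    using povm_carrier[OF x(1) that] by auto
  have "M c a = mat_sum n (\<lambda>l. complex_of_real (r a c l) \<cdot>\<^sub>m M x l) {..<d}" if "a < d" for a
  proof (rule eq_matI)
    fix i j assume "i < dim_row (mat_sum n (\<lambda>l. complex_of_real (r a c l) \<cdot>\<^sub>m M x l) {..<d})"
      "j < dim_col (mat_sum n (\<lambda>l. complex_of_real (r a c l) \<cdot>\<^sub>m M x l) {..<d})"
    then have ij: "i < n" "j < n" by auto
    have "mat_sum n (\<lambda>l. complex_of_real (r a c l) \<cdot>\<^sub>m M x l) {..<d} $$ (i, j)
        = (\<Sum>l<d. of_bool (a = e) * M x l $$ (i, j))"
      using ij by (auto simp: dim r_def intro!: sum.cong)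
    also have "\<dots> = of_bool (a = e) * mat_sum n (M x) {..<d} $$ (i, j)"
      using ij by (simp add: sum_distrib_left)
    also have "\<dots> = M c a $$ (i, j)"
      using ij by (simp add: povm_sum[OF x(1)] c deterministic_povm_def)
    finally show "M c a $$ (i, j) = mat_sum n (\<lambda>l. complex_of_real (r a c l) \<cdot>\<^sub>m M x l) {..<d} $$ (i, j)"
      by (rule sym)
  qed (auto simp: c deterministic_povm_def)
  moreover have "M x a = mat_sum n (\<lambda>l. complex_of_real (r a x l) \<cdot>\<^sub>m M x l) {..<d}" if "a < d" for a
  proof (rule eq_matI)
    fix i j assume "i < dim_row (mat_sum n (\<lambda>l. complex_of_real (r a x l) \<cdot>\<^sub>m M x l) {..<d})"
      "j < dim_col (mat_sum n (\<lambda>l. complex_of_real (r a x l) \<cdot>\<^sub>m M x l) {..<d})"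
    then have ij: "i < n" "j < n" by auto
    have "mat_sum n (\<lambda>l. complex_of_real (r a x l) \<cdot>\<^sub>m M x l) {..<d} $$ (i, j)
        = (\<Sum>l<d. if l = a then M x l $$ (i, j) else 0)"
      using ij x(2) unfolding mat_sum_index[OF ij] by (intro sum.cong) (auto simp: dim r_def)
    then show "M x a $$ (i, j) = mat_sum n (\<lambda>l. complex_of_real (r a x l) \<cdot>\<^sub>m M x l) {..<d} $$ (i, j)"
      using that by simp
  qed (use that dim in auto)
  moreover have "\<forall>z\<in>{c, x}. \<forall>l<d. (\<forall>a<d. 0 \<le> r a z l) \<and> (\<Sum>a<d. r a z l) = 1"
    using \<open>e < d\<close> x(2) by (auto simp: r_def of_bool_def)
  ultimately show ?thesis
    unfolding compatible_def using x(1) by (intro exI[of _ d] exI[of _ "M x"] exI[of _ r]) auto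
qed

lemma star_graph_deterministic:
  assumes "\<And>x. x \<in> {1..m} \<Longrightarrow> povm n d (M x)" "M c = deterministic_povm n e" "e < d" "c \<in> {1..m}"
  shows "star_graph m c \<subseteq> compatibility_structure n m d M"
  using assms by (auto simp: star_graph_def compatibility_structure_def intro: compatible_deterministic)

text \<open>All mass of \<open>t\<close> sits at \<open>(e, e')\<close>, so its other rows sum to
  zero. A nonnegative \<open>t'\<close> with the same row sums is then supported on row
  \<open>e\<close>, where each entry is the full column sum. It is applied with \<open>t\<close> at
  the pair of guessed settings and \<open>t'\<close> at another setting of the partner.\<close>

lemma concentrated_marginal:
  fixes t t' :: "nat \<Rightarrow> nat \<Rightarrow> real"
  assumes t: "\<And>a b. a < d \<Longrightarrow> b < d \<Longrightarrow> 0 \<le> t a b" "(\<Sum>a<d. \<Sum>b<d. t a b) = 1"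
    and e: "e < d" "e' < d" "t e e' = 1"
    and t': "\<And>a b. a < d \<Longrightarrow> b < d \<Longrightarrow> 0 \<le> t' a b"
    and marginal: "\<And>a. a < d \<Longrightarrow> (\<Sum>b<d. t' a b) = (\<Sum>b<d. t a b)"
    and "a < d" "b < d"
  shows "t' a b = (if a = e then \<Sum>a<d. t' a b else 0)"
proof -
  have zero: "t' a b = 0" if "a < d" "a \<noteq> e" "b < d" for a b
  proof -
    \<comment> \<open>Row \<open>e\<close> alone already has mass at least \<open>1\<close>, the
      total of \<open>t\<close>, which leaves nothing for row \<open>a\<close>.\<close>
    have "1 + (\<Sum>b<d. t a b) \<le> (\<Sum>b<d. t e b) + (\<Sum>b<d. t a b)"
      using member_le_sum[of e' "{..<d}" "t e"] t(1) e by simp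
    also have "\<dots> = (\<Sum>a\<in>{e, a}. \<Sum>b<d. t a b)"
      using that by simp
    also have "\<dots> \<le> (\<Sum>a<d. \<Sum>b<d. t a b)"
      using that e t(1) by (intro sum_mono2 sum_nonneg) auto
    finally have "(\<Sum>b<d. t' a b) \<le> 0"
      using t(2) marginal[OF that(1)] by simp
    moreover have "t' a b \<le> (\<Sum>b<d. t' a b)"
      using that t' by (intro member_le_sum) auto
    ultimately show ?thesis using t'[OF that(1,3)] by linarith
  qed
  have "(\<Sum>a<d. t' a b) = (\<Sum>a<d. if a = e then t' e b else 0)"
    using zero \<open>b < d\<close> by (intro sum.cong) auto
  then show ?thesis using zero assms(8,9) e by auto
qed

text \<open>At Alice's guessed setting the behavior is a point mass at \<open>e\<close> times Bob's
  marginal. The deterministic POVM reproduces exactly this with the same state, since its effect for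
  \<open>e\<close> is the identity.\<close>

lemma realizes_deterministic_left:
  assumes real: "realizes m d nA nB M N \<rho> p" and e: "e < d" "e' < d" "p e e' xs ys = 1"
    and xs: "xs \<in> {1..m}" and ys: "ys \<in> {1..m}"
  shows "realizes m d nA nB (M(xs := deterministic_povm nA e)) N \<rho> p"
proof -
  have "complex_of_real (p a b xs y) = mat_trace (kron (deterministic_povm nA e a) (N y b) * \<rho>)"
    if "a < d" "b < d" "y \<in> {1..m}" for a b y
  proof -
    have "(\<Sum>b<d. p a b xs y) = (\<Sum>b<d. p a b xs ys)" if "a < d" for a
      using realizes_marginal_left[OF real that xs \<open>y \<in> {1..m}\<close>]
        realizes_marginal_left[OF real that xs ys] by (metis of_real_eq_iff)
    then have "p a b xs y = (if a = e then \<Sum>a<d. p a b xs y else 0)"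
      using that by (intro concentrated_marginal[of d "\<lambda>a b. p a b xs ys" e e' "\<lambda>a b. p a b xs y"]
          realizes_nonneg[OF real] realizes_total[OF real] xs ys e) auto
    moreover have "kron (0\<^sub>m nA nA) (N y b) * \<rho> = 0\<^sub>m (nA * nB) (nA * nB)"
    proof -
      have B: "N y b \<in> carrier_mat nB nB" and \<rho>: "\<rho> \<in> carrier_mat (nA * nB) (nA * nB)"
        using real that by (auto simp: realizes_def density_operator_def intro: psd_carrier povm_carrier)
      have "kron (0\<^sub>m nA nA) (N y b) = 0\<^sub>m (nA * nB) (nA * nB)"
        using B by (intro eq_matI) (auto simp: kron_index div_mod_less_mult)
      then show ?thesis using \<rho> by simp
    qed
    ultimately show ?thesis
      using realizes_marginal_right[OF real \<open>b < d\<close> xs \<open>y \<in> {1..m}\<close>]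
      by (cases "a = e") (simp_all add: deterministic_povm_def mat_trace_def)
  qed
  then show ?thesis
    using real povm_deterministic[OF e(1), of nA] by (auto simp: realizes_def)
qed

lemma realizes_deterministic_right:
  assumes real: "realizes m d nA nB M N \<rho> p" and e: "e < d" "e' < d" "p e e' xs ys = 1"
    and xs: "xs \<in> {1..m}" and ys: "ys \<in> {1..m}"
  shows "realizes m d nA nB M (N(ys := deterministic_povm nB e')) \<rho> p"
proof -
  have "complex_of_real (p a b x ys) = mat_trace (kron (M x a) (deterministic_povm nB e' b) * \<rho>)"
    if "a < d" "b < d" "x \<in> {1..m}" for a b x
  proof -
    have "(\<Sum>a<d. p a b x ys) = (\<Sum>a<d. p a b xs ys)" if "b < d" for b
      using realizes_marginal_right[OF real that \<open>x \<in> {1..m}\<close> ys]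
        realizes_marginal_right[OF real that xs ys] by (metis of_real_eq_iff)
    \<comment> \<open>Here Bob's outcome indexes the rows, so the normalization is needed in the
      other order of summation.\<close>
    moreover have "(\<Sum>b<d. \<Sum>a<d. p a b xs ys) = 1"
      by (subst sum.swap) (rule realizes_total[OF real xs ys])
    ultimately have "p a b x ys = (if b = e' then \<Sum>b<d. p a b x ys else 0)"
      using that by (intro concentrated_marginal[of d "\<lambda>b a. p a b xs ys" e' e "\<lambda>b a. p a b x ys"]
          realizes_nonneg[OF real] xs ys e) auto
    moreover have "kron (M x a) (0\<^sub>m nB nB) * \<rho> = 0\<^sub>m (nA * nB) (nA * nB)"
    proof -
      have A: "M x a \<in> carrier_mat nA nA" and \<rho>: "\<rho> \<in> carrier_mat (nA * nB) (nA * nB)"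
        using real that by (auto simp: realizes_def density_operator_def intro: psd_carrier povm_carrier)
      have "kron (M x a) (0\<^sub>m nB nB) = 0\<^sub>m (nA * nB) (nA * nB)"
        using A by (intro eq_matI) (auto simp: kron_index div_mod_less_mult)
      then show ?thesis using \<rho> by simp
    qed
    ultimately show ?thesis
      using realizes_marginal_left[OF real \<open>a < d\<close> \<open>x \<in> {1..m}\<close> ys]
      by (cases "b = e'") (simp_all add: deterministic_povm_def mat_trace_def)
  qed
  then show ?thesis
    using real povm_deterministic[OF e(2), of nB] by (auto simp: realizes_def)
qed

text \<open>Replacing Alice's POVM leaves the behavior unchanged, so the same certain outcome pair
  justifies replacing Bob's afterwards. Each star then holds because its centre is
  deterministic.\<close>

lemma predictable_in_R_NL:
  assumes "p \<in> quantum_set m d" and e: "e < d" "e' < d" "p e e' xs ys = 1"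
    and xs: "xs \<in> {1..m}" and ys: "ys \<in> {1..m}"
  shows "p \<in> R_NL m d xs ys"
proof -
  obtain nA nB M N \<rho> where "realizes m d nA nB M N \<rho> p"
    using assms(1) unfolding quantum_set_def by blast
  then have real: "realizes m d nA nB (M(xs := deterministic_povm nA e))
      (N(ys := deterministic_povm nB e')) \<rho> p"
    by (intro realizes_deterministic_right[where p = p and xs = xs, OF _ e xs ys]
        realizes_deterministic_left[where p = p and ys = ys, OF _ e xs ys])
  have "star_graph m xs \<subseteq> compatibility_structure nA m d (M(xs := deterministic_povm nA e))"
    using real by (intro star_graph_deterministic[where e = e, OF _ _ e(1) xs]) (auto simp: realizes_def)
  moreover have "star_graph m ys \<subseteq> compatibility_structure nB m d (N(ys := deterministic_povm nB e'))"
    using real by (intro star_graph_deterministic[where e = e', OF _ _ e(2) ys]) (auto simp: realizes_def)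
  ultimately show ?thesis
    using real unfolding R_NL_def by blast
qed


section \<open>Direct sums and convexity\<close>

definition dsum :: "nat \<Rightarrow> nat \<Rightarrow> complex mat \<Rightarrow> complex mat \<Rightarrow> complex mat" where
  "dsum n m A B = mat (n + m) (n + m) (\<lambda>(i, j).
     if i < n \<and> j < n then A $$ (i, j) else if n \<le> i \<and> n \<le> j then B $$ (i - n, j - n) else 0)"

text \<open>The embedding of the first summand. Conjugation by it places an operator into the first
  block, and the adjoint conjugation cuts that block out again.\<close>

definition incl_left :: "nat \<Rightarrow> nat \<Rightarrow> complex mat" where
  "incl_left n m = mat (n + m) n (\<lambda>(i, j). of_bool (i = j))"

definition incl_right :: "nat \<Rightarrow> nat \<Rightarrow> complex mat" where
  "incl_right n m = mat (n + m) m (\<lambda>(i, j). of_bool (i = n + j))"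

lemma dsum_carrier [simp, intro]: "dsum n m A B \<in> carrier_mat (n + m) (n + m)"
  by (simp add: dsum_def)

lemma dim_dsum [simp]: "dim_row (dsum n m A B) = n + m" "dim_col (dsum n m A B) = n + m"
  by (simp_all add: dsum_def)

lemma incl_carrier [simp, intro]:
  "incl_left n m \<in> carrier_mat (n + m) n" "incl_right n m \<in> carrier_mat (n + m) m"
  by (simp_all add: incl_left_def incl_right_def)

lemma dsum_index:
  "i < n + m \<Longrightarrow> j < n + m \<Longrightarrow> dsum n m A B $$ (i, j) =
    (if i < n \<and> j < n then A $$ (i, j) else if n \<le> i \<and> n \<le> j then B $$ (i - n, j - n) else 0)"
  by (simp add: dsum_def)

lemma adj_mult_mult_index:
  assumes "J \<in> carrier_mat N n" "X \<in> carrier_mat N N" "i < n" "j < n"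
  shows "(adj J * X * J) $$ (i, j) = (\<Sum>l<N. (\<Sum>k<N. cnj (J $$ (k, i)) * X $$ (k, l)) * J $$ (l, j))"
  using assms unfolding times_mat_def by (simp add: scalar_prod_def lessThan_atLeast0)

lemma cnj_of_bool_mult: "cnj (of_bool P) * z = (if P then z else 0)"
  by simp

lemma compress_incl_left:
  assumes "A \<in> carrier_mat n n"
  shows "adj (incl_left n m) * dsum n m A B * incl_left n m = A"
proof (rule eq_matI)
  fix i j assume "i < dim_row A" "j < dim_col A"
  then have ij: "i < n" "j < n" using assms by auto
  have "(adj (incl_left n m) * dsum n m A B * incl_left n m) $$ (i, j)
      = (\<Sum>l<n + m. if l = j then \<Sum>k<n + m. if k = i then dsum n m A B $$ (k, l) else 0 else 0)"
    unfolding adj_mult_mult_index[OF incl_carrier(1) dsum_carrier ij]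
    using ij by (intro sum.cong) (auto simp: incl_left_def cnj_of_bool_mult)
  then show "(adj (incl_left n m) * dsum n m A B * incl_left n m) $$ (i, j) = A $$ (i, j)"
    using ij by (simp add: dsum_index)
qed (use assms in \<open>auto simp: incl_left_def\<close>)

lemma compress_incl_right:
  assumes "B \<in> carrier_mat m m"
  shows "adj (incl_right n m) * dsum n m A B * incl_right n m = B"
proof (rule eq_matI)
  fix i j assume "i < dim_row B" "j < dim_col B"
  then have ij: "i < m" "j < m" using assms by auto
  have "(adj (incl_right n m) * dsum n m A B * incl_right n m) $$ (i, j)
      = (\<Sum>l<n + m. if l = n + j then \<Sum>k<n + m. if k = n + i then dsum n m A B $$ (k, l) else 0 else 0)"
    unfolding adj_mult_mult_index[OF incl_carrier(2) dsum_carrier ij]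
    using ij by (intro sum.cong) (auto simp: incl_right_def cnj_of_bool_mult)
  then show "(adj (incl_right n m) * dsum n m A B * incl_right n m) $$ (i, j) = B $$ (i, j)"
    using ij by (simp add: dsum_index)
qed (use assms in \<open>auto simp: incl_right_def\<close>)

lemma sum_lessThan_add: "(\<Sum>i<n + m. f i) = (\<Sum>i<n. f i) + (\<Sum>i<m. f (n + i :: nat) :: complex)"
  by (induction m) (simp_all add: add.assoc)

lemma qform_dsum:
  "qform (n + m) (dsum n m A B) f g = qform n A f g + qform m B (\<lambda>i. f (n + i)) (\<lambda>i. g (n + i))"
  by (simp add: qform_def sum_lessThan_add dsum_index)

lemma psd_dsum: "psd n A \<Longrightarrow> psd m B \<Longrightarrow> psd (n + m) (dsum n m A B)"
  by (simp add: psd_iff_qform qform_dsum psd_qform)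

lemma dsum_one: "dsum n m (1\<^sub>m n) (1\<^sub>m m) = 1\<^sub>m (n + m)"
  by (rule eq_matI) (auto simp: dsum_index)

lemma mat_sum_dsum:
  "mat_sum (n + m) (\<lambda>k. dsum n m (F k) (F' k)) I = dsum n m (mat_sum n F I) (mat_sum m F' I)"
  by (rule eq_matI) (auto simp: dsum_index)

lemma povm_dsum:
  assumes "povm n d M" "povm m d M'"
  shows "povm (n + m) d (\<lambda>a. dsum n m (M a) (M' a))"
  using assms by (auto simp: povm_def mat_sum_dsum dsum_one intro: psd_dsum)

text \<open>The outcomes are the disjoint union of those of \<open>F\<close> and \<open>F'\<close>,
  each effect being extended by zero to the other summand. Adding effects of equal label would
  instead tie together parents with different numbers of outcomes and different responses.\<close>

definition dsum_append :: "nat \<Rightarrow> nat \<Rightarrow> nat \<Rightarrow> (nat \<Rightarrow> complex mat) \<Rightarrow> (nat \<Rightarrow> complex mat) \<Rightarrow> nat \<Rightarrow> complex mat" where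
  "dsum_append n m k F F' l =
     (if l < k then dsum n m (F l) (0\<^sub>m m m) else dsum n m (0\<^sub>m n n) (F' (l - k)))"

lemma mat_sum_dsum_append:
  "mat_sum (n + m) (dsum_append n m k F F') {..<k + k'} = dsum n m (mat_sum n F {..<k}) (mat_sum m F' {..<k'})"
  by (rule eq_matI) (auto simp: dsum_index dsum_append_def sum_lessThan_add)

lemma povm_dsum_append:
  assumes "povm n k G" "povm m k' G'"
  shows "povm (n + m) (k + k') (dsum_append n m k G G')"
  using assms unfolding povm_def
  by (auto simp: mat_sum_dsum_append dsum_one) (auto simp: dsum_append_def intro!: psd_dsum psd_zero)

lemma compatible_dsum:
  assumes "compatible n d M S" "compatible m d M' S"
  shows "compatible (n + m) d (\<lambda>x a. dsum n m (M x a) (M' x a)) S"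
proof -
  obtain k G and r :: "nat \<Rightarrow> nat \<Rightarrow> nat \<Rightarrow> real" where G: "povm n k G"
    and r: "\<forall>x\<in>S. \<forall>l<k. (\<forall>a<d. 0 \<le> r a x l) \<and> (\<Sum>a<d. r a x l) = 1"
    and M: "\<forall>x\<in>S. \<forall>a<d. M x a = mat_sum n (\<lambda>l. complex_of_real (r a x l) \<cdot>\<^sub>m G l) {..<k}"
    using assms(1) unfolding compatible_def by (elim exE conjE)
  obtain k' G' and r' :: "nat \<Rightarrow> nat \<Rightarrow> nat \<Rightarrow> real" where G': "povm m k' G'"
    and r': "\<forall>x\<in>S. \<forall>l<k'. (\<forall>a<d. 0 \<le> r' a x l) \<and> (\<Sum>a<d. r' a x l) = 1"
    and M': "\<forall>x\<in>S. \<forall>a<d. M' x a = mat_sum m (\<lambda>l. complex_of_real (r' a x l) \<cdot>\<^sub>m G' l) {..<k'}"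
    using assms(2) unfolding compatible_def by (elim exE conjE)
  \<comment> \<open>The parent's label reveals which summand it came from, so the response can
    follow the matching rule; labels from \<open>k\<close> on are shifted back by
    \<open>k\<close>.\<close>
  define s where "s a x l = (if l < k then r a x l else r' a x (l - k))" for a x l
  have dims: "l < k \<Longrightarrow> dim_row (G l) = n" "l < k \<Longrightarrow> dim_col (G l) = n"
    "l < k' \<Longrightarrow> dim_row (G' l) = m" "l < k' \<Longrightarrow> dim_col (G' l) = m" for l
    using povm_carrier[OF G] povm_carrier[OF G'] by auto
  have "(\<forall>a<d. 0 \<le> s a x l) \<and> (\<Sum>a<d. s a x l) = 1" if "x \<in> S" "l < k + k'" for x l
  proof (cases "l < k")
    case False
    then have "l - k < k'" using that by simp
    then show ?thesis using False r' that by (simp add: s_def)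
  qed (use r that in \<open>simp add: s_def\<close>)
  moreover have "dsum n m (M x a) (M' x a)
      = mat_sum (n + m) (\<lambda>l. complex_of_real (s a x l) \<cdot>\<^sub>m dsum_append n m k G G' l) {..<k + k'}"
    if "x \<in> S" "a < d" for x a
  proof -
    have "complex_of_real (s a x l) \<cdot>\<^sub>m dsum_append n m k G G' l = dsum_append n m k
        (\<lambda>l. complex_of_real (r a x l) \<cdot>\<^sub>m G l) (\<lambda>l. complex_of_real (r' a x l) \<cdot>\<^sub>m G' l) l"
      if "l < k + k'" for l
    proof (cases "l < k")
      case True
      then show ?thesis
        by (intro eq_matI) (auto simp: dsum_append_def s_def dsum_index dims)
    next
      case False
      then have "l - k < k'" using that by simp
      then show ?thesis
        using False by (intro eq_matI) (auto simp: dsum_append_def s_def dsum_index dims)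
    qed
    then have "mat_sum (n + m) (\<lambda>l. complex_of_real (s a x l) \<cdot>\<^sub>m dsum_append n m k G G' l) {..<k + k'}
      = mat_sum (n + m) (dsum_append n m k
        (\<lambda>l. complex_of_real (r a x l) \<cdot>\<^sub>m G l) (\<lambda>l. complex_of_real (r' a x l) \<cdot>\<^sub>m G' l)) {..<k + k'}"
      by (intro mat_sum_cong) simp
    then show ?thesis
      using that M M' by (simp add: mat_sum_dsum_append)
  qed
  ultimately show ?thesis
    unfolding compatible_def using povm_dsum_append[OF G G']
    by (intro exI[of _ "k + k'"] exI[of _ "dsum_append n m k G G'"] exI[of _ s]) simp
qed

lemma star_graph_dsum:
  assumes "star_graph k c \<subseteq> compatibility_structure n k d M" "star_graph k c \<subseteq> compatibility_structure m k d M'"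
  shows "star_graph k c \<subseteq> compatibility_structure (n + m) k d (\<lambda>x a. dsum n m (M x a) (M' x a))"
  using assms by (auto simp: compatibility_structure_def subset_iff intro: compatible_dsum)

text \<open>Behaviors are total functions, while feasibility fixes \<open>pobs\<close> only at the
  meaningful arguments. This bridges the two.\<close>

lemma R_NL_cong:
  assumes "p \<in> R_NL m d xs ys"
    and "\<And>a b x y. a < d \<Longrightarrow> b < d \<Longrightarrow> x \<in> {1..m} \<Longrightarrow> y \<in> {1..m} \<Longrightarrow> q a b x y = p a b x y"
  shows "q \<in> R_NL m d xs ys"
proof -
  have "realizes m d nA nB M N \<rho> q" if "realizes m d nA nB M N \<rho> p" for nA nB M N \<rho>
    using that assms(2) by (simp add: realizes_def)
  then show ?thesis using assms(1) unfolding R_NL_def by blast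
qed

text \<open>The tensor product of the two direct sums has four blocks. The state occupies only the
  two where both parties use the same realization, so the block acts as a shared classical flag with
  probabilities \<open>t\<close> and \<open>1 - t\<close>.\<close>

lemma R_NL_mixture:
  assumes "p \<in> R_NL m d xs ys" "p' \<in> R_NL m d xs ys" "0 \<le> t" "t \<le> 1"
  shows "(\<lambda>a b x y. t * p a b x y + (1 - t) * p' a b x y) \<in> R_NL m d xs ys"
proof -
  obtain n k M N \<rho> where real: "realizes m d n k M N \<rho> p"
    and star: "star_graph m xs \<subseteq> compatibility_structure n m d M"
      "star_graph m ys \<subseteq> compatibility_structure k m d N"
    using assms(1) by (auto simp: R_NL_def)
  obtain n' k' M' N' \<rho>' where real': "realizes m d n' k' M' N' \<rho>' p'"
    and star': "star_graph m xs \<subseteq> compatibility_structure n' m d M'"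
      "star_graph m ys \<subseteq> compatibility_structure k' m d N'"
    using assms(2) by (auto simp: R_NL_def)
  have \<rho>: "psd (n * k) \<rho>" and \<rho>': "psd (n' * k') \<rho>'"
    using real real' by (auto simp: realizes_def density_operator_def)
  define X where "X = kron (incl_left n n') (incl_left k k')"
  define Y where "Y = kron (incl_right n n') (incl_right k k')"
  define D where "D = (n + n') * (k + k')"
  \<comment> \<open>\<open>X\<close> and \<open>Y\<close> embed the two matching blocks, so this is
    the weighted block-diagonal state without mass on the mixed blocks.\<close>
  define \<sigma> where "\<sigma> = complex_of_real t \<cdot>\<^sub>m (X * \<rho> * adj X) + complex_of_real (1 - t) \<cdot>\<^sub>m (Y * \<rho>' * adj Y)"
  have X: "X \<in> carrier_mat D (n * k)" and Y: "Y \<in> carrier_mat D (n' * k')"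
    by (auto simp: X_def Y_def D_def)
  have psd: "psd D (X * \<rho> * adj X)" "psd D (Y * \<rho>' * adj Y)"
    using psd_congruence[OF \<rho>, of "adj X" D] psd_congruence[OF \<rho>', of "adj Y" D] X Y by auto
  have \<sigma>: "psd D \<sigma>"
    unfolding \<sigma>_def using psd assms(3,4) by (intro psd_add psd_smult) auto
  have tr: "mat_trace (kron (dsum n n' A A') (dsum k k' B B') * \<sigma>)
      = of_real t * mat_trace (kron A B * \<rho>) + of_real (1 - t) * mat_trace (kron A' B' * \<rho>')"
    if "A \<in> carrier_mat n n" "A' \<in> carrier_mat n' n'" "B \<in> carrier_mat k k" "B' \<in> carrier_mat k' k'"
    for A A' B B'
  proof -
    let ?E = "kron (dsum n n' A A') (dsum k k' B B')"
    have E: "?E \<in> carrier_mat D D" by (auto simp: D_def)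
    have "mat_trace (?E * (X * \<rho> * adj X)) = mat_trace (kron A B * \<rho>)"
      unfolding X_def using that psd_carrier[OF \<rho>]
      by (subst trace_kron_congruence[of _ "n + n'" n _ "k + k'" k]) (simp_all add: compress_incl_left)
    moreover have "mat_trace (?E * (Y * \<rho>' * adj Y)) = mat_trace (kron A' B' * \<rho>')"
      unfolding Y_def using that psd_carrier[OF \<rho>']
      by (subst trace_kron_congruence[of _ "n + n'" n' _ "k + k'" k']) (simp_all add: compress_incl_right)
    moreover have "?E * \<sigma> = of_real t \<cdot>\<^sub>m (?E * (X * \<rho> * adj X)) + of_real (1 - t) \<cdot>\<^sub>m (?E * (Y * \<rho>' * adj Y))"
      unfolding \<sigma>_def using E psd[THEN psd_carrier]
      by (simp add: mult_add_distrib_mat[of _ D D _ D] mult_smult_distrib[of _ D D _ D])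
    ultimately show ?thesis
      using mult_carrier_mat[OF E psd(1)[THEN psd_carrier]] mult_carrier_mat[OF E psd(2)[THEN psd_carrier]]
      by (simp add: mat_trace_add[of _ D] mat_trace_smult[of _ D])
  qed
  have "mat_trace \<sigma> = 1"
    using tr[of "1\<^sub>m n" "1\<^sub>m n'" "1\<^sub>m k" "1\<^sub>m k'"] psd_carrier[OF \<sigma>] real real'
    by (simp add: dsum_one kron_one realizes_def D_def density_operator_kron_one[unfolded kron_one])
  have "realizes m d (n + n') (k + k') (\<lambda>x a. dsum n n' (M x a) (M' x a))
      (\<lambda>y b. dsum k k' (N y b) (N' y b)) \<sigma> (\<lambda>a b x y. t * p a b x y + (1 - t) * p' a b x y)"
  proof -
    have M: "povm n d (M x)" "povm n' d (M' x)" if "x \<in> {1..m}" for x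
      using that real real' by (auto simp: realizes_def)
    have N: "povm k d (N y)" "povm k' d (N' y)" if "y \<in> {1..m}" for y
      using that real real' by (auto simp: realizes_def)
    have "complex_of_real (t * p a b x y + (1 - t) * p' a b x y)
        = mat_trace (kron (dsum n n' (M x a) (M' x a)) (dsum k k' (N y b) (N' y b)) * \<sigma>)"
      if "a < d" "b < d" "x \<in> {1..m}" "y \<in> {1..m}" for a b x y
      using that real real' tr[of "M x a" "M' x a" "N y b" "N' y b"] povm_carrier[OF M(1)]
        povm_carrier[OF M(2)] povm_carrier[OF N(1)] povm_carrier[OF N(2)]
      by (simp add: realizes_def)
    then show ?thesis
      using \<sigma> \<open>mat_trace \<sigma> = 1\<close> M N
      by (auto simp: realizes_def density_operator_def D_def intro: povm_dsum)
  qed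
  then show ?thesis
    unfolding R_NL_def using star_graph_dsum[OF star(1) star'(1)] star_graph_dsum[OF star(2) star'(2)]
    by blast
qed

text \<open>Membership is demanded only where the weight is positive: a guess of weight zero says
  nothing about the normalized behavior attached to it.\<close>

lemma R_NL_convex_combination:
  fixes c :: "'i \<Rightarrow> real"
  assumes "finite I" "\<And>i. i \<in> I \<Longrightarrow> 0 \<le> c i" "(\<Sum>i\<in>I. c i) = 1"
    "\<And>i. i \<in> I \<Longrightarrow> 0 < c i \<Longrightarrow> p i \<in> R_NL m d xs ys"
  shows "(\<lambda>a b x y. \<Sum>i\<in>I. c i * p i a b x y) \<in> R_NL m d xs ys"
  using assms
proof (induction I arbitrary: c rule: finite_induct)
  case (insert i I)
  have sum_I: "(\<Sum>j\<in>I. c j) = 1 - c i"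
    using insert.prems(2) insert.hyps by simp
  have ci: "0 \<le> c i" "c i \<le> 1"
    using insert.prems(1) sum_I sum_nonneg[of I c] by auto
  consider "c i = 0" | "c i = 1" | "0 < c i" "c i < 1" using ci by linarith
  then show ?case
  proof cases
    case 1
    then show ?thesis using insert.IH[of c] insert.prems insert.hyps sum_I by simp
  next
    case 2
    \<comment> \<open>Rescaling by \<open>1 - c i\<close> is impossible here, but all remaining
      weights vanish.\<close>
    then have "\<forall>j\<in>I. c j = 0"
      using sum_I insert.prems(1) insert.hyps sum_nonneg_eq_0_iff[of I c] by simp
    then show ?thesis
      using 2 insert.prems(3)[of i] insert.hyps by simp
  next
    case 3
    \<comment> \<open>The remaining weights are rescaled to total \<open>1\<close>, and the result
      is mixed with component \<open>i\<close>.\<close>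
    have "(\<lambda>a b x y. \<Sum>j\<in>I. c j / (1 - c i) * p j a b x y) \<in> R_NL m d xs ys"
      using 3 insert.prems(1,3) sum_I by (intro insert.IH) (auto simp: zero_less_divide_iff simp flip: sum_divide_distrib)
    then have "(\<lambda>a b x y. c i * p i a b x y + (1 - c i) * (\<Sum>j\<in>I. c j / (1 - c i) * p j a b x y)) \<in> R_NL m d xs ys"
      using 3 insert.prems(3)[of i] by (intro R_NL_mixture) auto
    then show ?thesis
      using 3 insert.hyps by (simp add: sum_distrib_left)
  qed
qed simp

section \<open>Guessing probability\<close>

lemma quantum_nonneg:
  "p \<in> quantum_set m d \<Longrightarrow> a < d \<Longrightarrow> b < d \<Longrightarrow> x \<in> {1..m} \<Longrightarrow> y \<in> {1..m} \<Longrightarrow> 0 \<le> p a b x y"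
  unfolding quantum_set_def using realizes_nonneg by blast

lemma quantum_total:
  "p \<in> quantum_set m d \<Longrightarrow> x \<in> {1..m} \<Longrightarrow> y \<in> {1..m} \<Longrightarrow> (\<Sum>a<d. \<Sum>b<d. p a b x y) = 1"
  unfolding quantum_set_def using realizes_total by blast

lemma quantum_le_one:
  assumes p: "p \<in> quantum_set m d" and "a < d" "b < d" "x \<in> {1..m}" "y \<in> {1..m}"
  shows "p a b x y \<le> 1"
proof -
  have "p a b x y \<le> (\<Sum>b<d. p a b x y)"
    using assms quantum_nonneg[OF p] by (intro member_le_sum) auto
  also have "\<dots> \<le> (\<Sum>a<d. \<Sum>b<d. p a b x y)"
    using assms quantum_nonneg[OF p]
    by (intro member_le_sum[of a _ "\<lambda>a. \<Sum>b<d. p a b x y"]) (auto intro: sum_nonneg)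
  finally show ?thesis using assms quantum_total[OF p] by simp
qed

lemma feasible_decomposition:
  assumes feas: "feasible m d pobs P" and Q: "pobs \<in> quantum_set m d"
    and xs: "xs \<in> {1..m}" and ys: "ys \<in> {1..m}"
  obtains c p where
    "\<And>e e'. e < d \<Longrightarrow> e' < d \<Longrightarrow> 0 \<le> c e e'"
    "\<And>e e'. e < d \<Longrightarrow> e' < d \<Longrightarrow> p e e' \<in> quantum_set m d"
    "\<And>e e' a b x y. e < d \<Longrightarrow> e' < d \<Longrightarrow> a < d \<Longrightarrow> b < d \<Longrightarrow> x \<in> {1..m} \<Longrightarrow> y \<in> {1..m} \<Longrightarrow>
       P e e' a b x y = c e e' * p e e' a b x y"
    "(\<Sum>e<d. \<Sum>e'<d. c e e') = 1"
proof -
  define decomp where "decomp e e' c p \<longleftrightarrow> 0 \<le> c \<and> p \<in> quantum_set m d \<and>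
      (\<forall>a<d. \<forall>b<d. \<forall>x\<in>{1..m}. \<forall>y\<in>{1..m}. P e e' a b x y = c * p a b x y)" for e e' c p
  have "\<exists>c p. decomp e e' c p" if "e < d" "e' < d" for e e'
  proof -
    have "P e e' \<in> unnormalized_quantum_set m d"
      using feas that by (simp add: feasible_def)
    then show ?thesis
      unfolding unnormalized_quantum_set_def decomp_def by blast
  qed
  then obtain c p where "\<And>e e'. e < d \<Longrightarrow> e' < d \<Longrightarrow> decomp e e' (c e e') (p e e')"
    by metis
  then have c: "\<And>e e'. e < d \<Longrightarrow> e' < d \<Longrightarrow> 0 \<le> c e e'"
    and p: "\<And>e e'. e < d \<Longrightarrow> e' < d \<Longrightarrow> p e e' \<in> quantum_set m d"
    and P: "\<And>e e' a b x y. e < d \<Longrightarrow> e' < d \<Longrightarrow> a < d \<Longrightarrow> b < d \<Longrightarrow> x \<in> {1..m} \<Longrightarrow> y \<in> {1..m} \<Longrightarrow>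
       P e e' a b x y = c e e' * p e e' a b x y"
    unfolding decomp_def by blast+
  \<comment> \<open>Each normalized behavior has total mass \<open>1\<close> at any single pair of
    settings, so summing outcomes there recovers its weight; the guessed pair is used.\<close>
  have "(\<Sum>e<d. \<Sum>e'<d. c e e') = (\<Sum>e<d. \<Sum>e'<d. \<Sum>a<d. \<Sum>b<d. P e e' a b xs ys)"
    using xs ys by (simp add: P quantum_total[OF p] flip: sum_distrib_left)
  also have "\<dots> = (\<Sum>e<d. \<Sum>a<d. \<Sum>e'<d. \<Sum>b<d. P e e' a b xs ys)"
    by (rule sum.cong[OF refl], rule sum.swap)
  also have "\<dots> = (\<Sum>e<d. \<Sum>a<d. \<Sum>b<d. \<Sum>e'<d. P e e' a b xs ys)"
    by (rule sum.cong[OF refl], rule sum.cong[OF refl], rule sum.swap)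
  also have "\<dots> = (\<Sum>a<d. \<Sum>e<d. \<Sum>b<d. \<Sum>e'<d. P e e' a b xs ys)"
    by (rule sum.swap)
  also have "\<dots> = (\<Sum>a<d. \<Sum>b<d. \<Sum>e<d. \<Sum>e'<d. P e e' a b xs ys)"
    by (rule sum.cong[OF refl], rule sum.swap)
  also have "\<dots> = (\<Sum>a<d. \<Sum>b<d. pobs a b xs ys)"
    using feas xs ys by (simp add: feasible_def)
  also have "\<dots> = 1" by (rule quantum_total[OF Q xs ys])
  finally show ?thesis using that c p P by blast
qed

text \<open>The value is an average of probabilities with weights \<open>c\<close>. It follows that
  being below \<open>1\<close> for all values is the same as never being equal to
  \<open>1\<close>.\<close>

lemma guess_values_le_one:
  assumes "v \<in> guess_values m d pobs xs ys" "pobs \<in> quantum_set m d"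
    and xs: "xs \<in> {1..m}" and ys: "ys \<in> {1..m}"
  shows "v \<le> 1"
proof -
  obtain P where v: "v = (\<Sum>e<d. \<Sum>e'<d. P e e' e e' xs ys)" and feas: "feasible m d pobs P"
    using assms(1) by (auto simp: guess_values_def)
  obtain c p where c_nonneg: "\<And>e e'. e < d \<Longrightarrow> e' < d \<Longrightarrow> 0 \<le> c e e'"
    and p: "\<And>e e'. e < d \<Longrightarrow> e' < d \<Longrightarrow> p e e' \<in> quantum_set m d"
    and P: "\<And>e e' a b x y. e < d \<Longrightarrow> e' < d \<Longrightarrow> a < d \<Longrightarrow> b < d \<Longrightarrow> x \<in> {1..m} \<Longrightarrow> y \<in> {1..m} \<Longrightarrow>
       P e e' a b x y = c e e' * p e e' a b x y"
    and c_sum: "(\<Sum>e<d. \<Sum>e'<d. c e e') = 1"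
    by (rule feasible_decomposition[OF feas assms(2) xs ys]) (rule that)
  have "v \<le> (\<Sum>e<d. \<Sum>e'<d. c e e')"
    unfolding v using c_nonneg quantum_le_one[OF p] xs ys
    by (intro sum_mono) (simp add: P mult_left_le)
  then show ?thesis using c_sum by simp
qed

lemma guess_one_R_NL:
  assumes "1 \<in> guess_values m d pobs xs ys" "pobs \<in> quantum_set m d"
    and xs: "xs \<in> {1..m}" and ys: "ys \<in> {1..m}"
  shows "pobs \<in> R_NL m d xs ys"
proof -
  obtain P where v: "1 = (\<Sum>e<d. \<Sum>e'<d. P e e' e e' xs ys)" and feas: "feasible m d pobs P"
    using assms(1) by (auto simp: guess_values_def)
  obtain c p where c_nonneg: "\<And>e e'. e < d \<Longrightarrow> e' < d \<Longrightarrow> 0 \<le> c e e'"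
    and p: "\<And>e e'. e < d \<Longrightarrow> e' < d \<Longrightarrow> p e e' \<in> quantum_set m d"
    and P: "\<And>e e' a b x y. e < d \<Longrightarrow> e' < d \<Longrightarrow> a < d \<Longrightarrow> b < d \<Longrightarrow> x \<in> {1..m} \<Longrightarrow> y \<in> {1..m} \<Longrightarrow>
       P e e' a b x y = c e e' * p e e' a b x y"
    and c_sum: "(\<Sum>e<d. \<Sum>e'<d. c e e') = 1"
    by (rule feasible_decomposition[OF feas assms(2) xs ys]) (rule that)
  define I where "I = {..<d} \<times> {..<d}"
  have finite_I: "finite I" by (simp add: I_def)
  \<comment> \<open>The weights and the score both total \<open>1\<close>, so the weighted failure
    probabilities sum to zero. Being nonnegative they all vanish, which gives certainty wherever the
    weight is positive.\<close>
  have "(\<Sum>(e, e')\<in>I. c e e' * (1 - p e e' e e' xs ys)) = 0"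
    using v c_sum xs ys by (simp add: I_def P right_diff_distrib sum_subtractf flip: sum.cartesian_product)
  moreover have "\<forall>i\<in>I. 0 \<le> (case i of (e, e') \<Rightarrow> c e e' * (1 - p e e' e e' xs ys))"
    using c_nonneg quantum_le_one[OF p] xs ys by (auto simp: I_def)
  ultimately have zero: "\<forall>i\<in>I. (case i of (e, e') \<Rightarrow> c e e' * (1 - p e e' e e' xs ys)) = 0"
    using sum_nonneg_eq_0_iff[of I "\<lambda>(e, e'). c e e' * (1 - p e e' e e' xs ys)"] finite_I by blast
  have one: "p e e' e e' xs ys = 1" if "e < d" "e' < d" "0 < c e e'" for e e'
    using bspec[OF zero, of "(e, e')"] that by (simp add: I_def)
  have "(\<lambda>a b x y. \<Sum>i\<in>I. (\<lambda>(e, e'). c e e') i * (\<lambda>(e, e'). p e e') i a b x y) \<in> R_NL m d xs ys"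
  proof (rule R_NL_convex_combination)
    show "(\<Sum>i\<in>I. (\<lambda>(e, e'). c e e') i) = 1"
      using c_sum by (simp add: I_def sum.cartesian_product)
    show "(\<lambda>(e, e'). p e e') i \<in> R_NL m d xs ys" if "i \<in> I" "0 < (\<lambda>(e, e'). c e e') i" for i
    proof -
      obtain e e' where i: "i = (e, e')" "e < d" "e' < d"
        using \<open>i \<in> I\<close> by (auto simp: I_def)
      have "p e e' \<in> R_NL m d xs ys"
        by (rule predictable_in_R_NL[where e = e and e' = e'])
          (use i that one p xs ys in \<open>simp_all del: atLeastAtMost_iff\<close>)
      then show ?thesis by (simp add: i)
    qed
  qed (auto simp: I_def c_nonneg)
  then show ?thesis
  proof (rule R_NL_cong)
    fix a b x y assume "a < d" "b < d" "x \<in> {1..m}" "y \<in> {1..m}"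
    then have "pobs a b x y = (\<Sum>e<d. \<Sum>e'<d. c e e' * p e e' a b x y)"
      using feas by (simp add: feasible_def flip: P)
    then show "pobs a b x y = (\<Sum>i\<in>I. (\<lambda>(e, e'). c e e') i * (\<lambda>(e, e'). p e e') i a b x y)"
      by (simp add: I_def sum.cartesian_product case_prod_unfold)
  qed
qed

theorem mainTheorem2:
  fixes m d xs ys :: nat and pobs :: behavior
  assumes "m \<ge> 1" and "d \<ge> 1"
    and "pobs \<in> quantum_set m d"
    and "xs \<in> {1..m}" and "ys \<in> {1..m}"
  shows "P_guess_NL_less m d pobs xs ys 1 \<longleftrightarrow> pobs \<notin> R_NL m d xs ys"
proof -
  have "P_guess_NL_less m d pobs xs ys 1 \<longleftrightarrow> 1 \<notin> guess_values m d pobs xs ys"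
    using guess_values_le_one[OF _ assms(3-5)] unfolding P_guess_NL_less_def
    by (metis less_le)
  then show ?thesis
    using R_NL_guess_one[OF _ assms(4,5)] guess_one_R_NL[OF _ assms(3-5)] by blast
qed

end
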